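(* Let $\{M_k\}_{k\ge1}$ be a sequence of matrices with entries in $[-1,1]$, where $M_k$ has order $m_k\times n_k$ and $m_k,n_k\to\infty$ as $k\to\infty$. Let $\mathcal{M}\subseteq[-1,1]$ be the union of the sets of entries of all the matrices $M_k$, and let $f:\mathcal{M}\to[0,1]$ be a function such that the $(i,j)$-th entry of $M_k$ is revealed (without noise) with probability $f((M_k)_{ij})$ and hidden otherwise, independently of all else. Suppose that $\sup_k\operatorname{rank}(M_k)<\infty$. Let $\mu_k$ be the empirical distribution of the $m_kn_k$ entries of $M_k$. Suppose that for every subsequential weak limit $\mu$ of the sequence $\{\mu_k\}_{k\ge1}$, there is an extension of $f$ to a measurable function from $[-1,1]$ into $[0,1]$, also denoted by $f$, such that $f$ is nonzero and continuous almost everywhere with respect to $\mu$. Then the modified Candès–Recht estimator $\hat M_k$ of $M_k$ is consistent, that is, $$\lim_{k\to\infty}\mathbb{E}\Bigl[\frac1{m_kn_k}\sum_{i=1}^{m_k}\sum_{j=1}^{n_k}\bigl((\hat M_k)_{ij}-(M_k)_{ij}\bigr)^2\Bigr]=0.$$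
   Context: The nuclear norm $\|Z\|_*$ of a matrix $Z$ is the sum of its singular values. Given an $m\times n$ matrix $M$ with entries in $[-1,1]$ and the set $\Omega$ of indices $(i,j)$ of its revealed entries, the modified Candès–Recht estimator $\hat M$ is a matrix of minimal nuclear norm among all $m\times n$ matrices $Z$ with $z_{ij}=m_{ij}$ for all $(i,j)\in\Omega$ and $|z_{ij}|\le1$ for all $i,j$. (If the minimizer is not unique, $\hat M$ is any minimizer, chosen as a function of the observed data.) *)

theory Defs
  imports
    "HOL-Probability.Probability"
    "Jordan_Normal_Form.Char_Poly"
    "Jordan_Normal_Form.DL_Rank"
begin

text \<open>Matrices have varying order, so they are elements of type \<^typ>\<open>real mat\<close>, whose
  indices start at 0.\<close>

definition entries :: "real mat \<Rightarrow> (nat \<times> nat) set" where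
  "entries A = {..<dim_row A} \<times> {..<dim_col A}"

definition mat_rank :: "real mat \<Rightarrow> nat" where
  "mat_rank A = vec_space.rank (dim_row A) A"

text \<open>The square roots of the eigenvalues of \<open>A\<^sup>T A\<close>, with multiplicity. All complex roots of
  this characteristic polynomial are real and nonnegative, so no eigenvalue is lost by taking
  roots over the reals. The multiset has \<^term>\<open>dim_col A\<close> elements: relative to the convention
  with \<^term>\<open>min (dim_row A) (dim_col A)\<close> singular values, only zeros are added.\<close>

definition singular_values :: "real mat \<Rightarrow> real multiset" where
  "singular_values A = image_mset sqrt (proots (char_poly (transpose_mat A * A)))"

definition nuclear_norm :: "real mat \<Rightarrow> real" where
  "nuclear_norm A = sum_mset (singular_values A)"

text \<open>The observed data: the partial function giving the value of each revealed entry. Its domain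
  is the set of revealed positions.\<close>

definition observed :: "real mat \<Rightarrow> (nat \<times> nat) set \<Rightarrow> (nat \<times> nat \<rightharpoonup> real)" where
  "observed A \<Omega> = (\<lambda>ij. Some (A $$ ij)) |` (entries A \<inter> \<Omega>)"

definition candes_recht_feasible ::
    "nat \<Rightarrow> nat \<Rightarrow> (nat \<times> nat \<rightharpoonup> real) \<Rightarrow> real mat \<Rightarrow> bool" where
  "candes_recht_feasible m n d Z \<longleftrightarrow>
     Z \<in> carrier_mat m n \<and>
     (\<forall>ij v. d ij = Some v \<longrightarrow> Z $$ ij = v) \<and>
     (\<forall>i<m. \<forall>j<n. \<bar>Z $$ (i, j)\<bar> \<le> 1)"

definition is_candes_recht_estimate ::
    "nat \<Rightarrow> nat \<Rightarrow> (nat \<times> nat \<rightharpoonup> real) \<Rightarrow> real mat \<Rightarrow> bool" where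
  "is_candes_recht_estimate m n d Z \<longleftrightarrow>
     is_arg_min nuclear_norm (candes_recht_feasible m n d) Z"

definition empirical_distribution :: "real mat \<Rightarrow> real measure" where
  "empirical_distribution A = distr (uniform_count_measure (entries A)) borel (\<lambda>ij. A $$ ij)"

definition subseq_weak_limit :: "(nat \<Rightarrow> real measure) \<Rightarrow> real measure \<Rightarrow> bool" where
  "subseq_weak_limit \<mu> \<nu> \<longleftrightarrow>
     real_distribution \<nu> \<and> (\<exists>r. strict_mono r \<and> weak_conv_m (\<lambda>k. \<mu> (r k)) \<nu>)"

text \<open>\<open>R\<close> is the random set of revealed positions. Positions outside the matrix are ignored.\<close>

definition reveals_independently ::
    "'w measure \<Rightarrow> ('w \<Rightarrow> (nat \<times> nat) set) \<Rightarrow> real mat \<Rightarrow> (real \<Rightarrow> real) \<Rightarrow> bool" where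
  "reveals_independently P R A f \<longleftrightarrow>
     prob_space.indep_events P (\<lambda>ij. {\<omega> \<in> space P. ij \<in> R \<omega>}) (entries A) \<and>
     (\<forall>ij\<in>entries A. measure P {\<omega> \<in> space P. ij \<in> R \<omega>} = f (A $$ ij))"

end

theory Submission
  imports Defs "Jordan_Normal_Form.Schur_Decomposition"
begin

text \<open>Let \<open>D\<close> be the difference of the estimate and the true \<open>m \<times> n\<close> matrix, and let \<open>p\<close> be the
  matrix of reveal probabilities. Since \<open>D\<close> vanishes on the revealed set \<open>\<Omega>\<close>, the sum of
  \<open>p D\<^sup>2\<close> equals the sum of \<open>(p - 1\<^sub>\<Omega>) D\<^sup>2\<close>, a centred linear statistic of \<open>\<Omega>\<close>
  evaluated at a matrix of small complexity: the minimality of the estimate and the rank bound give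
  \<open>D\<close> a nuclear norm of order \<open>\<surd>(mn)\<close>. Symmetrization and the contraction principle for
  \<open>x \<mapsto> x\<^sup>2\<close> on \<open>[-2, 2]\<close> bound its mean by the mean of the largest pairing of such a \<open>D\<close> with
  a random sign matrix, hence, by duality of the nuclear and the operator norm and a fourth moment
  bound for the latter, by a multiple of \<open>mn (1/m + 1/n)\<^sup>1\<^sup>/\<^sup>4\<close>. So the mean square error is small on the
  entries where \<open>f\<close> is bounded away from \<open>0\<close>. The remaining entries form a small proportion: otherwise
  a weak limit of the empirical distributions would, in its Skorohod representation, give positive
  mass to the zeros of \<open>f\<close>.\<close>

unbundle no inner_syntax

section \<open>Singular values and the nuclear norm\<close>

text \<open>Moving the symmetric matrix to the other side of the pairing of \<open>v\<close> with
  \<open>conjugate v\<close> turns the factor \<open>k\<close> into \<open>cnj k\<close>, and this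
  pairing is nonzero.\<close>

lemma complex_eigenvalue_symmetric_real:
  assumes A: "A \<in> carrier_mat n n" and sym: "A\<^sup>T = (A :: real mat)"
    and ev: "eigenvector (map_mat complex_of_real A) v k"
  shows "k \<in> \<real>"
proof -
  let ?A = "map_mat complex_of_real A"
  have cA: "?A \<in> carrier_mat n n" using A by simp
  from ev A have v: "v \<in> carrier_vec n" and v0: "v \<noteq> 0\<^sub>v n" and eq: "?A *\<^sub>v v = k \<cdot>\<^sub>v v"
    unfolding eigenvector_def by auto
  have adj: "conjugate v \<in> carrier_vec n" using v by simp
  have "conjugate (?A *\<^sub>v v) = ?A *\<^sub>v conjugate v"
    using A v by (intro eq_vecI) (auto simp: scalar_prod_def)
  hence cv: "?A *\<^sub>v conjugate v = cnj k \<cdot>\<^sub>v conjugate v"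
    unfolding eq by (simp add: conjugate_smult_vec)
  have symc: "?A\<^sup>T = ?A" using sym by (metis map_mat_transpose)
  have "k * (v \<bullet> conjugate v) = (?A *\<^sub>v v) \<bullet> conjugate v"
    unfolding eq using v by simp
  also have "\<dots> = v \<bullet> (?A *\<^sub>v conjugate v)"
    using transpose_vec_mult_scalar[OF cA adj v] symc by simp
  also have "\<dots> = cnj k * (v \<bullet> conjugate v)"
    unfolding cv using v by simp
  finally have "k = cnj k"
    using v v0 conjugate_square_eq_0_vec[OF v] by auto
  thus ?thesis by (simp add: complex_is_Real_iff complex_eq_iff)
qed

text \<open>The fundamental theorem of algebra gives a complex root of the characteristic
  polynomial; symmetry makes it real, and a real root has a real eigenvector.\<close>

lemma real_symmetric_eigenvector:
  assumes A: "A \<in> carrier_mat n n" and sym: "A\<^sup>T = (A :: real mat)" and n: "n > 0"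
  obtains v k where "eigenvector A v k"
proof -
  let ?A = "map_mat complex_of_real A"
  have cA: "?A \<in> carrier_mat n n" using A by simp
  have "\<not> constant (poly (char_poly ?A))"
    using degree_monic_char_poly[OF cA] n by (simp add: constant_degree)
  then obtain z where z: "poly (char_poly ?A) z = 0"
    using fundamental_theorem_of_algebra by blast
  then obtain v where v: "eigenvector ?A v z"
    using eigenvalue_root_char_poly[OF cA] unfolding eigenvalue_def by auto
  from complex_eigenvalue_symmetric_real[OF A sym v] obtain k where k: "z = of_real k"
    by (auto elim: Reals_cases)
  have "poly (char_poly A) k = 0"
    using z unfolding k of_real_hom.char_poly_hom[OF A] by simp
  thus ?thesis
    using eigenvalue_root_char_poly[OF A] that unfolding eigenvalue_def by auto
qed

text \<open>Complete \<open>v\<close> to a basis, orthogonalize by Gram-Schmidt, which keeps the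
  head of the list, and normalize. The scalar \<open>c\<close> is the normalizing factor of the
  first vector.\<close>

lemma orthogonal_matrix_with_first_column:
  assumes v: "(v :: real vec) \<in> carrier_vec n" and v0: "v \<noteq> 0\<^sub>v n"
  obtains W c where "W \<in> carrier_mat n n" "W\<^sup>T * W = 1\<^sub>m n" "col W 0 = c \<cdot>\<^sub>v v"
proof -
  interpret cof_vec_space n "TYPE(real)" .
  define b where "b = basis_completion v"
  from basis_completion[OF v v0, folded b_def]
  have dist_b: "distinct b" and indep: "\<not> lin_dep (set b)" and b: "set b \<subseteq> carrier_vec n"
    and hdb: "hd b = v" and len_b: "length b = n" by auto
  have n: "n > 0" using v v0 by (cases n) auto
  from hdb len_b n obtain vs where bv: "b = v # vs" by (cases b) auto
  define ws where "ws = gram_schmidt n b"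
  from gram_schmidt_result[OF b dist_b indep refl, folded ws_def]
  have ws: "set ws \<subseteq> carrier_vec n" "corthogonal ws" "length ws = n"
    by (auto simp: len_b)
  from gram_schmidt_hd[OF v, of vs, folded bv] have hdws: "hd ws = v" unfolding ws_def .
  have wsc: "ws ! i \<in> carrier_vec n" if "i < n" for i using ws that by auto
  define us where "us = map (\<lambda>w. (1 / sqrt (w \<bullet> w)) \<cdot>\<^sub>v w) ws"
  have us: "set us \<subseteq> carrier_vec n" "length us = n"
    using ws by (auto simp: us_def)
  have orth: "us ! i \<bullet> us ! j = (if i = j then 1 else 0)" if ij: "i < n" "j < n" for i j
  proof -
    \<comment> \<open>Over the reals \<open>corthogonal\<close> means orthogonality of nonzero
      vectors, so dividing by the lengths is legitimate.\<close>
    have "ws ! i \<bullet> ws ! j = 0 \<longleftrightarrow> i \<noteq> j"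
      using corthogonalD[OF ws(2)] ij ws(3) by simp
    moreover have "ws ! i \<bullet> ws ! i \<ge> 0" by (simp add: scalar_prod_def sum_nonneg)
    ultimately show ?thesis
      using ij ws wsc[OF ij(1)] wsc[OF ij(2)] by (auto simp: us_def)
  qed
  define W where "W = mat_of_cols n us"
  have W: "W \<in> carrier_mat n n" using mat_of_cols_carrier(1)[of n us] us(2) by (simp only: W_def)
  have colW: "col W i = us ! i" if "i < n" for i
  proof -
    have "us ! i \<in> carrier_vec n" using us that by (metis nth_mem subsetD)
    thus ?thesis unfolding W_def using us(2) that by (intro col_mat_of_cols) auto
  qed
  show ?thesis
  proof (rule that)
    show "W \<in> carrier_mat n n" by (rule W)
    show "W\<^sup>T * W = 1\<^sub>m n"
    proof (rule eq_matI)
      fix i j assume "i < dim_row (1\<^sub>m n :: real mat)" "j < dim_col (1\<^sub>m n :: real mat)"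
      then show "(W\<^sup>T * W) $$ (i, j) = 1\<^sub>m n $$ (i, j)"
        using us(2) orth W colW by simp
    qed (use W in auto)
    show "col W 0 = (1 / sqrt (v \<bullet> v)) \<cdot>\<^sub>v v"
    proof -
      have "ws ! 0 = v" using hdws n ws(3) by (metis hd_conv_nth length_0_conv less_irrefl)
      thus ?thesis using colW[OF n] n ws(3) by (simp add: us_def)
    qed
  qed
qed

lemma orthogonal_right_inverse:
  assumes "(W :: real mat) \<in> carrier_mat n n" "W\<^sup>T * W = 1\<^sub>m n"
  shows "W * W\<^sup>T = 1\<^sub>m n"
  using assms mat_mult_left_right_inverse[of "W\<^sup>T" n W] by simp

text \<open>Deflation: an orthogonal change of basis moves an eigenvector to the first coordinate,
  symmetry splits off a block of size 1, and the induction hypothesis treats the rest.\<close>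

theorem real_symmetric_orthogonally_diagonalizable:
  assumes "A \<in> carrier_mat n n" and "A\<^sup>T = (A :: real mat)"
  shows "\<exists>U \<in> carrier_mat n n. U\<^sup>T * U = 1\<^sub>m n \<and> diagonal_mat (U\<^sup>T * A * U)"
  using assms
proof (induction n arbitrary: A)
  case 0
  then show ?case by (intro bexI[of _ "1\<^sub>m 0"]) (auto simp: diagonal_mat_def)
next
  case (Suc n A)
  note A = Suc.prems(1) and sym = Suc.prems(2)
  obtain v k where ev: "eigenvector A v k"
    using real_symmetric_eigenvector[OF A sym] by auto
  have v: "v \<in> carrier_vec (Suc n)" and v0: "v \<noteq> 0\<^sub>v (Suc n)" and Av: "A *\<^sub>v v = k \<cdot>\<^sub>v v"
    using ev A unfolding eigenvector_def by auto
  obtain W c where W: "W \<in> carrier_mat (Suc n) (Suc n)" and WW: "W\<^sup>T * W = 1\<^sub>m (Suc n)"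
    and col0: "col W 0 = c \<cdot>\<^sub>v v"
    using orthogonal_matrix_with_first_column[OF v v0] by blast
  define B where "B = W\<^sup>T * A * W"
  have B: "B \<in> carrier_mat (Suc n) (Suc n)" using W A by (simp add: B_def)
  have Bsym: "B\<^sup>T = B"
    unfolding B_def using W A sym
    by (subst transpose_mult[of _ "Suc n" "Suc n" _ "Suc n"], simp, simp)
      (subst transpose_mult[of _ "Suc n" "Suc n" _ "Suc n"], auto intro!: assoc_mult_mat[symmetric])
  \<comment> \<open>The first column of \<open>W\<close> is a multiple of the eigenvector, so
    \<open>A\<close> scales it by \<open>k\<close>, and \<open>W\<^sup>T\<close> carries it to the
    first unit vector.\<close>
  have "col B 0 = W\<^sup>T *\<^sub>v (A *\<^sub>v col W 0)"
  proof -
    have "col B 0 = col (W\<^sup>T * (A * W)) 0"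
      unfolding B_def using W A by (subst assoc_mult_mat[of _ "Suc n" "Suc n" _ "Suc n" _ "Suc n"]) auto
    also have "\<dots> = W\<^sup>T *\<^sub>v col (A * W) 0"
      by (rule col_mult2[of _ "Suc n" "Suc n" _ "Suc n"]) (use W A in auto)
    also have "col (A * W) 0 = A *\<^sub>v col W 0"
      by (rule col_mult2[of _ "Suc n" "Suc n" _ "Suc n"]) (use W A in auto)
    finally show ?thesis .
  qed
  also have "A *\<^sub>v col W 0 = k \<cdot>\<^sub>v col W 0"
    unfolding col0 using A v by (simp add: mult_mat_vec[of A "Suc n" "Suc n"] Av smult_smult_assoc mult.commute)
  also have "W\<^sup>T *\<^sub>v (k \<cdot>\<^sub>v col W 0) = k \<cdot>\<^sub>v col (W\<^sup>T * W) 0"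
  proof -
    have "col (W\<^sup>T * W) 0 = W\<^sup>T *\<^sub>v col W 0"
      by (rule col_mult2[of _ "Suc n" "Suc n" _ "Suc n"]) (use W in auto)
    moreover have "col W 0 \<in> carrier_vec (Suc n)" using col_dim[of W 0] W by (metis carrier_matD(1))
    ultimately show ?thesis using W by (metis mult_mat_vec transpose_carrier_mat)
  qed
  finally have colB: "col B 0 = k \<cdot>\<^sub>v unit_vec (Suc n) 0"
    unfolding WW by simp
  have B0: "B $$ (Suc i, 0) = 0" if "i < n" for i
    using arg_cong[OF colB, of "\<lambda>w. w $ Suc i"] B that by simp
  have B0': "B $$ (0, Suc i) = 0" if "i < n" for i
    using B0[OF that] Bsym B that by (metis Suc_less_eq carrier_matD(1) carrier_matD(2) index_transpose_mat(1) zero_less_Suc)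
  define C where "C = mat n n (\<lambda>(i, j). B $$ (Suc i, Suc j))"
  have C: "C \<in> carrier_mat n n" by (simp add: C_def)
  define K where "K = mat 1 1 (\<lambda>_. B $$ (0, 0))"
  have K: "K \<in> carrier_mat 1 1" by (simp add: K_def)
  have Bblock: "B = four_block_mat K (0\<^sub>m 1 n) (0\<^sub>m n 1) C"
  proof (rule eq_matI)
    fix i j
    assume "i < dim_row (four_block_mat K (0\<^sub>m 1 n) (0\<^sub>m n 1) C)"
      "j < dim_col (four_block_mat K (0\<^sub>m 1 n) (0\<^sub>m n 1) C)"
    thus "B $$ (i, j) = four_block_mat K (0\<^sub>m 1 n) (0\<^sub>m n 1) C $$ (i, j)"
      using B0 B0' by (cases i; cases j) (auto simp: K_def C_def)
  qed (use B K C in auto)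
  have Csym: "C\<^sup>T = C"
  proof (rule eq_matI)
    fix i j assume "i < dim_row C" "j < dim_col C"
    thus "C\<^sup>T $$ (i, j) = C $$ (i, j)"
      using arg_cong[OF Bsym, of "\<lambda>M. M $$ (Suc i, Suc j)"] B by (simp add: C_def)
  qed (use C in auto)
  obtain V where V: "V \<in> carrier_mat n n" and VV: "V\<^sup>T * V = 1\<^sub>m n"
    and diag: "diagonal_mat (V\<^sup>T * C * V)"
    using Suc.IH[OF C Csym] by blast
  define Q where "Q = four_block_mat (1\<^sub>m 1) (0\<^sub>m 1 n) (0\<^sub>m n 1) V"
  have Q: "Q \<in> carrier_mat (Suc n) (Suc n)"
    using four_block_carrier_mat[of "1\<^sub>m 1" 1 1 V n n "0\<^sub>m 1 n" "0\<^sub>m n 1"] V by (simp add: Q_def)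
  have QT: "Q\<^sup>T = four_block_mat (1\<^sub>m 1) (0\<^sub>m 1 n) (0\<^sub>m n 1) (V\<^sup>T)"
    unfolding Q_def using V
    by (subst transpose_four_block_mat[of _ 1 1 _ n _ n]) auto
  have QQ: "Q\<^sup>T * Q = 1\<^sub>m (Suc n)"
    unfolding QT unfolding Q_def using V VV
    by (subst mult_four_block_mat[of _ 1 1 _ n _ n _ _ 1 _ n])
      (auto simp: four_block_one_mat[of 1 n, simplified])
  have QBQ: "Q\<^sup>T * B * Q = four_block_mat K (0\<^sub>m 1 n) (0\<^sub>m n 1) (V\<^sup>T * C * V)"
  proof -
    have "Q\<^sup>T * B = four_block_mat K (0\<^sub>m 1 n) (0\<^sub>m n 1) (V\<^sup>T * C)"
      unfolding QT unfolding Bblock using V K C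
      by (subst mult_four_block_mat[of _ 1 1 _ n _ n _ _ 1 _ n]) auto
    thus ?thesis
      unfolding Q_def using V K C
      by (simp, subst mult_four_block_mat[of _ 1 1 _ n _ n _ _ 1 _ n]) auto
  qed
  have dQBQ: "diagonal_mat (Q\<^sup>T * B * Q)"
    unfolding QBQ using diag K V C
    by (auto simp: diagonal_mat_def)
  define U where "U = W * Q"
  have U: "U \<in> carrier_mat (Suc n) (Suc n)" using W Q by (simp add: U_def)
  have UT: "U\<^sup>T = Q\<^sup>T * W\<^sup>T"
    unfolding U_def using W Q by (rule transpose_mult)
  have c: "Q\<^sup>T \<in> carrier_mat (Suc n) (Suc n)" "W\<^sup>T \<in> carrier_mat (Suc n) (Suc n)" using W Q by auto
  note ac = assoc_mult_mat[of _ "Suc n" "Suc n" _ "Suc n" _ "Suc n"]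
  have "U\<^sup>T * U = Q\<^sup>T * (W\<^sup>T * W) * Q"
    unfolding UT unfolding U_def using W Q c by (simp add: ac)
  also have "\<dots> = 1\<^sub>m (Suc n)" unfolding WW using Q QQ by simp
  finally have UU: "U\<^sup>T * U = 1\<^sub>m (Suc n)" .
  have "U\<^sup>T * A * U = Q\<^sup>T * B * Q"
    unfolding UT B_def unfolding U_def using W Q c A by (simp add: ac)
  with dQBQ UU U show ?case by auto
qed

section \<open>Singular values as column lengths in an orthogonal basis\<close>

lemma index_mult_mat_sum:
  assumes "A \<in> carrier_mat m n" "B \<in> carrier_mat n l" "i < m" "j < l"
  shows "(A * B) $$ (i, j) = (\<Sum>k<n. A $$ (i, k) * (B $$ (k, j) :: 'a :: semiring_0))"
  using assms by (simp add: scalar_prod_def lessThan_atLeast0)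

text \<open>Since \<open>U\<^sup>T\<close> inverts \<open>U\<close>, the matrix is similar to a
  diagonal one, and similarity preserves the characteristic polynomial with the multiplicities of
  its roots.\<close>

lemma proots_char_poly_orthogonally_diagonalizable:
  assumes A: "A \<in> carrier_mat n n" and U: "U \<in> carrier_mat n n" and UU: "U\<^sup>T * U = 1\<^sub>m n"
    and diag: "diagonal_mat (U\<^sup>T * (A :: real mat) * U)"
  shows "proots (char_poly A) = mset (diag_mat (U\<^sup>T * A * U))"
proof -
  let ?D = "U\<^sup>T * A * U"
  have D: "?D \<in> carrier_mat n n" using A U by simp
  have "similar_mat ?D A"
    unfolding similar_mat_def
    by (intro exI, rule similar_mat_witI[of "U\<^sup>T" U n])
      (use A U UU orthogonal_right_inverse[OF U UU] in auto)
  hence "char_poly A = char_poly ?D" by (rule char_poly_similar[symmetric])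
  also have "\<dots> = (\<Prod>a\<leftarrow>diag_mat ?D. [:- a, 1:])"
    using D diag by (intro char_poly_upper_triangular[of _ n])
      (auto simp: diagonal_mat_def intro!: upper_triangularI)
  finally have cp: "char_poly A = (\<Prod>a\<leftarrow>diag_mat ?D. [:- a, 1:])" .
  have "proots (\<Prod>a\<leftarrow>xs. [:- a, 1:]) = mset xs" for xs :: "real list"
  proof (induction xs)
    case (Cons x xs)
    have "(\<Prod>a\<leftarrow>xs. [:- a, 1:]) \<noteq> 0" by (auto simp: prod_list_zero_iff)
    hence "proots ([:- x, 1:] * (\<Prod>a\<leftarrow>xs. [:- a, 1:])) = {#x#} + mset xs"
      using Cons by (subst proots_mult) auto
    thus ?case by simp
  qed simp
  thus ?thesis unfolding cp by simp
qed

text \<open>Take \<open>U\<close> diagonalizing \<open>Z\<^sup>T * Z\<close>. The Gram matrix of the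
  columns of \<open>Z * U\<close> is then diagonal: the columns are orthogonal and their lengths are
  the singular values.\<close>

lemma nuclear_norm_orthogonal_basis:
  assumes Z: "Z \<in> carrier_mat m n"
  obtains U where "U \<in> carrier_mat n n" "U\<^sup>T * U = 1\<^sub>m n"
    "\<And>j k. j < n \<Longrightarrow> k < n \<Longrightarrow> j \<noteq> k \<Longrightarrow> (\<Sum>i<m. (Z * U) $$ (i, j) * (Z * U) $$ (i, k)) = 0"
    "nuclear_norm Z = (\<Sum>j<n. sqrt (\<Sum>i<m. ((Z * U) $$ (i, j))\<^sup>2))"
proof -
  let ?A = "Z\<^sup>T * Z"
  have A: "?A \<in> carrier_mat n n" using Z by simp
  have sym: "?A\<^sup>T = ?A" using Z by (subst transpose_mult[of _ n m _ n]) auto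
  from real_symmetric_orthogonally_diagonalizable[OF A sym]
  obtain U where U: "U \<in> carrier_mat n n" and UU: "U\<^sup>T * U = 1\<^sub>m n"
    and diag: "diagonal_mat (U\<^sup>T * ?A * U)" by blast
  define B where "B = Z * U"
  have B: "B \<in> carrier_mat m n" using Z U by (simp add: B_def)
  define D where "D = U\<^sup>T * ?A * U"
  have D: "D \<in> carrier_mat n n" using A U by (simp add: D_def)
  have "B\<^sup>T = U\<^sup>T * Z\<^sup>T" unfolding B_def using Z U by (rule transpose_mult)
  hence "B\<^sup>T * B = (U\<^sup>T * Z\<^sup>T) * (Z * U)" unfolding B_def by simp
  also have "\<dots> = U\<^sup>T * (Z\<^sup>T * (Z * U))"
    by (rule assoc_mult_mat[of _ n n _ m _ n]) (use Z U in auto)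
  also have "Z\<^sup>T * (Z * U) = ?A * U"
    by (rule assoc_mult_mat[of _ n m _ n _ n, symmetric]) (use Z U in auto)
  also have "U\<^sup>T * (?A * U) = D" unfolding D_def
    by (rule assoc_mult_mat[of _ n n _ n _ n, symmetric]) (use A U in auto)
  finally have BB: "D = B\<^sup>T * B" ..
  have Djk: "D $$ (j, k) = (\<Sum>i<m. B $$ (i, j) * B $$ (i, k))" if "j < n" "k < n" for j k
    unfolding BB using that B by (subst index_mult_mat_sum[of _ n m _ n]) auto
  have "singular_values Z = image_mset sqrt (mset (diag_mat D))"
    unfolding singular_values_def D_def
    using proots_char_poly_orthogonally_diagonalizable[OF A U UU diag] by simp
  hence "nuclear_norm Z = sum_list (map sqrt (diag_mat D))"
    unfolding nuclear_norm_def by (metis mset_map sum_mset_sum_list)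
  also have "\<dots> = (\<Sum>j<n. sqrt (D $$ (j, j)))"
    using D by (simp add: diag_mat_def comp_def interv_sum_list_conv_sum_set_nat lessThan_atLeast0)
  also have "\<dots> = (\<Sum>j<n. sqrt (\<Sum>i<m. (B $$ (i, j))\<^sup>2))"
    using Djk by (intro sum.cong) (auto simp: power2_eq_square)
  finally have nn: "nuclear_norm Z = (\<Sum>j<n. sqrt (\<Sum>i<m. (B $$ (i, j))\<^sup>2))" .
  show ?thesis
  proof (rule that[OF U UU])
    show "nuclear_norm Z = (\<Sum>j<n. sqrt (\<Sum>i<m. ((Z * U) $$ (i, j))\<^sup>2))"
      using nn by (simp only: B_def)
    fix j k assume jk: "j < n" "k < n" "j \<noteq> k"
    have "D $$ (j, k) = 0" using diag jk D unfolding diagonal_mat_def D_def by auto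
    thus "(\<Sum>i<m. (Z * U) $$ (i, j) * (Z * U) $$ (i, k)) = 0"
      using Djk[OF jk(1,2)] by (simp only: B_def)
  qed
qed

section \<open>Bounding a matrix pairing by the nuclear norm\<close>

text \<open>Right multiplication by an orthogonal matrix acts on each row separately and preserves
  inner products of rows.\<close>

lemma sum_entries_mult_orthogonal:
  assumes E: "E \<in> carrier_mat m n" and Z: "Z \<in> carrier_mat m n"
    and U: "(U :: real mat) \<in> carrier_mat n n" and UU: "U\<^sup>T * U = 1\<^sub>m n"
  shows "(\<Sum>i<m. \<Sum>j<n. E $$ (i, j) * Z $$ (i, j))
       = (\<Sum>i<m. \<Sum>j<n. (E * U) $$ (i, j) * (Z * U) $$ (i, j))"
proof (rule sum.cong[OF refl])
  fix i assume "i \<in> {..<m}"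
  hence i: "i < m" by simp
  have UU': "U * U\<^sup>T = 1\<^sub>m n" by (rule orthogonal_right_inverse[OF U UU])
  \<comment> \<open>What collapses the double sum is orthonormality of the rows of \<open>U\<close>,
    obtained from that of its columns.\<close>
  have Ujk: "(\<Sum>l<n. U $$ (j, l) * U $$ (k, l)) = (if j = k then 1 else 0)" if "j < n" "k < n" for j k
    using arg_cong[OF UU', of "\<lambda>M. M $$ (j, k)"] index_mult_mat_sum[of U n n "U\<^sup>T" n j k] that U
    by simp
  have "(\<Sum>l<n. (E * U) $$ (i, l) * (Z * U) $$ (i, l))
      = (\<Sum>l<n. (\<Sum>j<n. E $$ (i, j) * U $$ (j, l)) * (\<Sum>k<n. Z $$ (i, k) * U $$ (k, l)))"
    by (rule sum.cong[OF refl], subst (1 2) index_mult_mat_sum[of _ m n _ n])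
      (use E Z U i in auto)
  also have "\<dots> = (\<Sum>l<n. \<Sum>j<n. \<Sum>k<n. E $$ (i, j) * Z $$ (i, k) * (U $$ (j, l) * U $$ (k, l)))"
    by (simp only: sum_product mult_ac)
  also have "\<dots> = (\<Sum>j<n. \<Sum>l<n. \<Sum>k<n. E $$ (i, j) * Z $$ (i, k) * (U $$ (j, l) * U $$ (k, l)))"
    by (rule sum.swap)
  also have "\<dots> = (\<Sum>j<n. \<Sum>k<n. \<Sum>l<n. E $$ (i, j) * Z $$ (i, k) * (U $$ (j, l) * U $$ (k, l)))"
    by (rule sum.cong[OF refl], rule sum.swap)
  also have "\<dots> = (\<Sum>j<n. \<Sum>k<n. E $$ (i, j) * Z $$ (i, k) * (if j = k then 1 else 0))"
    by (intro sum.cong[OF refl]) (simp add: sum_distrib_left[symmetric] Ujk)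
  also have "\<dots> = (\<Sum>j<n. E $$ (i, j) * Z $$ (i, j))"
    by (simp add: if_distrib[of "\<lambda>x. _ * x"] cong: if_cong)
  finally show "(\<Sum>j<n. E $$ (i, j) * Z $$ (i, j)) = (\<Sum>l<n. (E * U) $$ (i, l) * (Z * U) $$ (i, l))" ..
qed

text \<open>The squared Frobenius norm of \<open>E\<^sup>T E\<close>. Its fourth root bounds the operator norm of \<open>E\<close>, and
  for random signs its mean is an elementary fourth moment.\<close>

definition gram_sq :: "nat \<Rightarrow> nat \<Rightarrow> (nat \<Rightarrow> nat \<Rightarrow> real) \<Rightarrow> real" where
  "gram_sq m n E = (\<Sum>j<n. \<Sum>k<n. (\<Sum>i<m. E i j * E i k)\<^sup>2)"

text \<open>The left side is the Frobenius pairing of \<open>E\<^sup>T E\<close> with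
  \<open>u u\<^sup>T\<close> (\<open>G\<close> and \<open>w\<close> in the proof). The latter has
  Frobenius norm 1, so Cauchy-Schwarz applies.\<close>

lemma norm_mult_vec_le_gram_sq:
  assumes u: "(\<Sum>j<n. (u j)\<^sup>2) = 1"
  shows "(\<Sum>i<m. (\<Sum>j<n. E i j * u j)\<^sup>2) \<le> sqrt (gram_sq m n E)"
proof -
  let ?I = "{..<n} \<times> {..<n}"
  define G where "G = (\<lambda>(j, k). \<Sum>i<m. E i j * E i k)"
  define w where "w = (\<lambda>(j, k). u j * u k)"
  have "(\<Sum>i<m. (\<Sum>j<n. E i j * u j)\<^sup>2) = (\<Sum>i<m. \<Sum>j<n. \<Sum>k<n. E i j * E i k * (u j * u k))"
    by (simp only: power2_eq_square sum_product mult_ac)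
  also have "\<dots> = (\<Sum>j<n. \<Sum>i<m. \<Sum>k<n. E i j * E i k * (u j * u k))"
    by (rule sum.swap)
  also have "\<dots> = (\<Sum>j<n. \<Sum>k<n. \<Sum>i<m. E i j * E i k * (u j * u k))"
    by (rule sum.cong[OF refl], rule sum.swap)
  also have "\<dots> = (\<Sum>j<n. \<Sum>k<n. (\<Sum>i<m. E i j * E i k) * (u j * u k))"
    by (simp add: sum_distrib_right)
  also have "\<dots> = (\<Sum>p\<in>?I. G p * w p)"
    unfolding sum.cartesian_product
    by (rule sum.cong[OF refl]) (auto simp: G_def w_def)
  finally have eq: "(\<Sum>i<m. (\<Sum>j<n. E i j * u j)\<^sup>2) = (\<Sum>p\<in>?I. G p * w p)" .
  have "(\<Sum>p\<in>?I. G p * w p)\<^sup>2 \<le> (\<Sum>p\<in>?I. (G p)\<^sup>2) * (\<Sum>p\<in>?I. (w p)\<^sup>2)"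
    by (rule Cauchy_Schwarz_ineq_sum)
  also have "(\<Sum>p\<in>?I. (w p)\<^sup>2) = (\<Sum>j<n. (u j)\<^sup>2) * (\<Sum>j<n. (u j)\<^sup>2)"
    by (simp add: sum_product sum.cartesian_product w_def case_prod_unfold power_mult_distrib)
  also have "(\<Sum>p\<in>?I. (G p)\<^sup>2) = gram_sq m n E"
    by (simp add: gram_sq_def sum.cartesian_product G_def case_prod_unfold)
  finally show ?thesis unfolding eq u by (intro real_le_rsqrt) simp
qed

text \<open>In the basis \<open>U\<close> the pairing splits into inner products of columns. The
  columns of \<open>E' * U\<close> are images of unit vectors, hence no longer than the fourth root,
  and the lengths of the columns of \<open>Z * U\<close> add up to the nuclear norm.\<close>

theorem sum_entries_mult_le_nuclear_norm:
  assumes Z: "Z \<in> carrier_mat m n"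
  shows "\<bar>\<Sum>i<m. \<Sum>j<n. E i j * Z $$ (i, j)\<bar> \<le> root 4 (gram_sq m n E) * nuclear_norm Z"
proof -
  obtain U where U: "U \<in> carrier_mat n n" and UU: "U\<^sup>T * U = 1\<^sub>m n"
    and nn: "nuclear_norm Z = (\<Sum>j<n. sqrt (\<Sum>i<m. ((Z * U) $$ (i, j))\<^sup>2))"
    by (rule nuclear_norm_orthogonal_basis[OF Z])
  define E' where "E' = mat m n (\<lambda>(i, j). E i j)"
  have E': "E' \<in> carrier_mat m n" by (simp add: E'_def)
  have col_unit: "(\<Sum>i<n. (U $$ (i, j))\<^sup>2) = 1" if "j < n" for j
    using arg_cong[OF UU, of "\<lambda>M. M $$ (j, j)"] index_mult_mat_sum[of "U\<^sup>T" n n U n j j] that U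
    by (simp add: power2_eq_square)
  have Ecol: "sqrt (\<Sum>i<m. ((E' * U) $$ (i, j))\<^sup>2) \<le> root 4 (gram_sq m n E)" if j: "j < n" for j
  proof -
    have "(\<Sum>i<m. ((E' * U) $$ (i, j))\<^sup>2) = (\<Sum>i<m. (\<Sum>k<n. E i k * U $$ (k, j))\<^sup>2)"
      by (rule sum.cong[OF refl], subst index_mult_mat_sum[of _ m n _ n])
        (use E' U j in \<open>auto simp: E'_def\<close>)
    also have "\<dots> \<le> sqrt (gram_sq m n E)"
      by (rule norm_mult_vec_le_gram_sq[OF col_unit[OF j]])
    finally have "sqrt (\<Sum>i<m. ((E' * U) $$ (i, j))\<^sup>2) \<le> sqrt (sqrt (gram_sq m n E))" by simp
    also have "\<dots> = root 4 (gram_sq m n E)"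
      unfolding sqrt_def by (simp add: real_root_mult_exp[symmetric])
    finally show ?thesis .
  qed
  have "(\<Sum>i<m. \<Sum>j<n. E i j * Z $$ (i, j)) = (\<Sum>i<m. \<Sum>j<n. E' $$ (i, j) * Z $$ (i, j))"
    by (intro sum.cong) (auto simp: E'_def)
  also have "\<dots> = (\<Sum>i<m. \<Sum>j<n. (E' * U) $$ (i, j) * (Z * U) $$ (i, j))"
    by (rule sum_entries_mult_orthogonal[OF E' Z U UU])
  also have "\<dots> = (\<Sum>j<n. \<Sum>i<m. (E' * U) $$ (i, j) * (Z * U) $$ (i, j))"
    by (rule sum.swap)
  finally have "\<bar>\<Sum>i<m. \<Sum>j<n. E i j * Z $$ (i, j)\<bar>
      \<le> (\<Sum>j<n. \<bar>\<Sum>i<m. (E' * U) $$ (i, j) * (Z * U) $$ (i, j)\<bar>)"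
    by (simp only: sum_abs)
  also have "\<dots> \<le> (\<Sum>j<n. root 4 (gram_sq m n E) * sqrt (\<Sum>i<m. ((Z * U) $$ (i, j))\<^sup>2))"
  proof (rule sum_mono)
    fix j assume j: "j \<in> {..<n}"
    have "\<bar>\<Sum>i<m. (E' * U) $$ (i, j) * (Z * U) $$ (i, j)\<bar>
        \<le> sqrt (\<Sum>i<m. ((E' * U) $$ (i, j))\<^sup>2) * sqrt (\<Sum>i<m. ((Z * U) $$ (i, j))\<^sup>2)"
      unfolding real_sqrt_mult[symmetric]
      by (rule real_le_rsqrt) (simp add: Cauchy_Schwarz_ineq_sum)
    also have "\<dots> \<le> root 4 (gram_sq m n E) * sqrt (\<Sum>i<m. ((Z * U) $$ (i, j))\<^sup>2)"
      using Ecol j by (intro mult_right_mono) (auto intro!: sum_nonneg)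
    finally show "\<bar>\<Sum>i<m. (E' * U) $$ (i, j) * (Z * U) $$ (i, j)\<bar>
        \<le> root 4 (gram_sq m n E) * sqrt (\<Sum>i<m. ((Z * U) $$ (i, j))\<^sup>2)" .
  qed
  also have "\<dots> = root 4 (gram_sq m n E) * nuclear_norm Z"
    unfolding nn by (simp add: sum_distrib_left)
  finally show ?thesis .
qed

section \<open>Nuclear norm, rank and Frobenius norm\<close>

text \<open>\<open>rank\<close> is the dimension of the column span as a vector space of its own, so
  the independence of \<open>S\<close> is first carried over to that subspace.\<close>

lemma (in vec_space) card_lin_indpt_le_rank:
  assumes A: "A \<in> carrier_mat n nc" and li: "lin_indpt S" and S: "S \<subseteq> span (set (cols A))"
  shows "card S \<le> rank A"
proof -
  have cols: "set (cols A) \<subseteq> carrier_vec n" using A cols_dim by blast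
  have sub: "submodule class_ring (span (set (cols A))) V"
    using span_is_submodule[of "set (cols A)"] cols by simp
  interpret W: vectorspace class_ring "span_vs (set (cols A))"
    using cols by (intro span_is_subspace subspace_is_vs) simp
  have "W.lin_indpt S" using span_li_not_depend(2)[OF S sub] li by simp
  moreover have "W.fin_dim" using fin_dim_span_cols[OF A] .
  ultimately show ?thesis unfolding rank_def
    using S by (intro W.li_le_dim(2)) auto
qed

text \<open>The nonzero columns of \<open>Z * U\<close> are pairwise orthogonal, hence independent,
  and they lie in the column space of \<open>Z\<close>.\<close>

lemma card_nonzero_orthogonal_cols_le_rank:
  assumes Z: "Z \<in> carrier_mat m n" and U: "U \<in> carrier_mat n l"
    and orth: "\<And>j k. j < l \<Longrightarrow> k < l \<Longrightarrow> j \<noteq> k \<Longrightarrow>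
      (\<Sum>i<m. (Z * U) $$ (i, j) * (Z * U) $$ (i, k)) = 0"
  shows "card {j. j < l \<and> (\<Sum>i<m. ((Z * U) $$ (i, j))\<^sup>2) \<noteq> 0} \<le> mat_rank Z"
proof -
  interpret vec_space "TYPE(real)" m .
  define B where "B = Z * U"
  have B: "B \<in> carrier_mat m l" using Z U by (simp add: B_def)
  define J where "J = {j. j < l \<and> (\<Sum>i<m. (B $$ (i, j))\<^sup>2) \<noteq> 0}"
  have finJ: "finite J" by (simp add: J_def)
  define js where "js = sorted_list_of_set J"
  have js: "set js = J" "distinct js" using finJ by (simp_all add: js_def)
  have jsl: "js ! t < l" "(\<Sum>i<m. (B $$ (i, js ! t))\<^sup>2) \<noteq> 0" if "t < length js" for t
    using nth_mem[OF that] js(1) by (auto simp: J_def)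
  have Borth: "(\<Sum>i<m. B $$ (i, js ! s) * B $$ (i, js ! t)) = 0"
    if "s < length js" "t < length js" "s \<noteq> t" for s t
    unfolding B_def using that jsl js(2) by (intro orth) (auto simp: nth_eq_iff_index_eq)
  define bs where "bs = map (col B) js"
  have bsi: "bs ! t $ i = B $$ (i, js ! t)" if "t < length js" "i < m" for t i
    using that jsl(1)[OF that(1)] B by (simp add: bs_def)
  have bs: "set bs \<subseteq> carrier_vec m" using B by (auto simp: bs_def intro: carrier_vecI)
  have lbs: "length bs = length js" by (simp add: bs_def)
  \<comment> \<open>Two equal columns at different places would be orthogonal to themselves, hence
    zero, against the choice of \<open>J\<close>.\<close>
  have dbs: "distinct bs"
    unfolding distinct_conv_nth lbs
  proof (intro allI impI notI)
    fix s t assume st: "s < length js" "t < length js" "s \<noteq> t" "bs ! s = bs ! t"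
    have "(\<Sum>i<m. (B $$ (i, js ! t))\<^sup>2) = (\<Sum>i<m. B $$ (i, js ! s) * B $$ (i, js ! t))"
      using st bsi by (intro sum.cong) (auto simp: power2_eq_square, metis)
    thus False using Borth[OF st(1-3)] jsl(2)[OF st(2)] by simp
  qed
  define C where "C = mat_of_cols m bs"
  have C: "C \<in> carrier_mat m (length js)"
    unfolding C_def lbs[symmetric] by (rule mat_of_cols_carrier(1))
  have cC: "cols C = bs" unfolding C_def by (rule cols_mat_of_cols[OF bs])
  have Cit: "C $$ (i, t) = B $$ (i, js ! t)" if "i < m" "t < length js" for i t
    unfolding C_def using that lbs bsi by (simp add: mat_of_cols_index)
  have li: "lin_indpt (set bs)"
  proof
    assume "lin_dep (set bs)"
    then obtain v where v: "v \<in> carrier_vec (length js)" "v \<noteq> 0\<^sub>v (length js)"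
      and Cv: "C *\<^sub>v v = 0\<^sub>v m"
      using lin_depE[OF C] cC dbs by metis
    have "v $ t = 0" if t: "t < length js" for t
    proof -
      have Cv0: "(\<Sum>s<length js. B $$ (i, js ! s) * v $ s) = 0" if "i < m" for i
      proof -
        have "(C *\<^sub>v v) $ i = (\<Sum>s<length js. C $$ (i, s) * v $ s)"
          using that C v(1) by (simp add: scalar_prod_def lessThan_atLeast0)
        thus ?thesis using Cit that Cv by simp
      qed
      \<comment> \<open>Pairing the relation \<open>C *\<^sub>v v = 0\<^sub>v m\<close> with the
        column at \<open>t\<close> isolates the coefficient \<open>v $ t\<close>.\<close>
      have "0 = (\<Sum>i<m. B $$ (i, js ! t) * (\<Sum>s<length js. B $$ (i, js ! s) * v $ s))"
        using Cv0 by simp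
      also have "\<dots> = (\<Sum>i<m. \<Sum>s<length js. v $ s * (B $$ (i, js ! s) * B $$ (i, js ! t)))"
        by (simp add: sum_distrib_left mult_ac)
      also have "\<dots> = (\<Sum>s<length js. \<Sum>i<m. v $ s * (B $$ (i, js ! s) * B $$ (i, js ! t)))"
        by (rule sum.swap)
      also have "\<dots> = (\<Sum>s<length js. v $ s * (\<Sum>i<m. B $$ (i, js ! s) * B $$ (i, js ! t)))"
        by (simp add: sum_distrib_left)
      also have "\<dots> = (\<Sum>s<length js. if s = t then v $ t * (\<Sum>i<m. (B $$ (i, js ! t))\<^sup>2) else 0)"
        using Borth t by (intro sum.cong) (auto simp: power2_eq_square)
      also have "\<dots> = v $ t * (\<Sum>i<m. (B $$ (i, js ! t))\<^sup>2)"
        using t by simp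
      finally show ?thesis using jsl(2)[OF t] by simp
    qed
    hence "v = 0\<^sub>v (length js)" using v(1) by (intro eq_vecI) auto
    thus False using v(2) by simp
  qed
  have "set bs \<subseteq> span (set (cols Z))"
  proof
    fix x assume "x \<in> set bs"
    then obtain j where j: "j < l" and x: "x = col B j" using js by (auto simp: bs_def J_def)
    have "x = Z *\<^sub>v col U j" unfolding x B_def by (rule col_mult2[OF Z U j])
    moreover have "col U j \<in> carrier_vec n" using U by (auto intro: carrier_vecI)
    ultimately show "x \<in> span (set (cols Z))"
      unfolding col_space_def[symmetric] col_space_eq[OF Z]
      using Z x B by (auto intro!: carrier_vecI)
  qed
  hence "card (set bs) \<le> rank Z" by (rule card_lin_indpt_le_rank[OF Z li])
  moreover have "card (set bs) = card J"
    using dbs js distinct_card lbs by metis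
  moreover have "mat_rank Z = rank Z" using Z by (simp add: mat_rank_def)
  ultimately show ?thesis by (simp add: J_def B_def)
qed

text \<open>Cauchy-Schwarz over the nonzero singular values: there are at most
  \<open>mat_rank Z\<close> of them, and their squares add up to the squared Frobenius norm.\<close>

theorem nuclear_norm_le_rank:
  assumes Z: "Z \<in> carrier_mat m n"
  shows "nuclear_norm Z \<le> sqrt (mat_rank Z) * sqrt (\<Sum>i<m. \<Sum>j<n. (Z $$ (i, j))\<^sup>2)"
proof -
  obtain U where U: "U \<in> carrier_mat n n" and UU: "U\<^sup>T * U = 1\<^sub>m n"
    and orth: "\<And>j k. j < n \<Longrightarrow> k < n \<Longrightarrow> j \<noteq> k \<Longrightarrow>
      (\<Sum>i<m. (Z * U) $$ (i, j) * (Z * U) $$ (i, k)) = 0"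
    and nn: "nuclear_norm Z = (\<Sum>j<n. sqrt (\<Sum>i<m. ((Z * U) $$ (i, j))\<^sup>2))"
    using nuclear_norm_orthogonal_basis[OF Z] by blast
  define s where "s j = (\<Sum>i<m. ((Z * U) $$ (i, j))\<^sup>2)" for j
  define J where "J = {j. j < n \<and> s j \<noteq> 0}"
  have s0: "s j \<ge> 0" for j by (simp add: s_def sum_nonneg)
  have cJ: "card J \<le> mat_rank Z"
    unfolding J_def s_def by (rule card_nonzero_orthogonal_cols_le_rank[OF Z U orth])
  have J: "J \<subseteq> {..<n}" by (auto simp: J_def)
  \<comment> \<open>Zero singular values are dropped first, so that the constant factor 1
    contributes \<open>card J\<close> and not \<open>n\<close>.\<close>
  have "nuclear_norm Z = (\<Sum>j\<in>J. 1 * sqrt (s j))"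
    unfolding nn s_def[symmetric] mult_1
    by (rule sum.mono_neutral_right) (auto simp: J_def)
  hence "(nuclear_norm Z)\<^sup>2 \<le> (\<Sum>j\<in>J. 1\<^sup>2) * (\<Sum>j\<in>J. (sqrt (s j))\<^sup>2)"
    using Cauchy_Schwarz_ineq_sum[of "\<lambda>_. 1" "\<lambda>j. sqrt (s j)" J] by simp
  also have "\<dots> = real (card J) * (\<Sum>j\<in>J. s j)" using s0 by simp
  also have "\<dots> \<le> real (mat_rank Z) * (\<Sum>j<n. s j)"
    using cJ s0 J by (intro mult_mono sum_mono2) (auto intro: sum_nonneg)
  also have "(\<Sum>j<n. s j) = (\<Sum>i<m. \<Sum>j<n. (Z $$ (i, j))\<^sup>2)"
    unfolding s_def power2_eq_square sum_entries_mult_orthogonal[OF Z Z U UU] by (rule sum.swap)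
  finally show ?thesis
    unfolding real_sqrt_mult[symmetric] by (rule real_le_rsqrt)
qed

section \<open>Averages over independent random subsets\<close>

text \<open>The mean of \<open>h\<close> at a random subset of \<open>I\<close> containing each
  \<open>i\<close> independently with probability \<open>p i\<close>. The finite sum allows
  induction over \<open>I\<close>.\<close>

definition bernoulli_avg :: "('i \<Rightarrow> real) \<Rightarrow> 'i set \<Rightarrow> ('i set \<Rightarrow> real) \<Rightarrow> real" where
  "bernoulli_avg p I h = (\<Sum>S\<in>Pow I. (\<Prod>i\<in>I. if i \<in> S then p i else 1 - p i) * h S)"

lemma bernoulli_avg_empty [simp]: "bernoulli_avg p {} h = h {}"
  by (simp add: bernoulli_avg_def)

text \<open>Conditioning on whether \<open>i\<close> is chosen; this recursion drives the inductions
  over \<open>I\<close>.\<close>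

lemma bernoulli_avg_insert:
  assumes fin: "finite I" and i: "i \<notin> I"
  shows "bernoulli_avg p (insert i I) h
       = bernoulli_avg p I (\<lambda>S. p i * h (insert i S) + (1 - p i) * h S)"
proof -
  let ?w = "\<lambda>I S. \<Prod>i\<in>I. if i \<in> S then p i else 1 - p i"
  have w1: "?w (insert i I) (insert i S) = p i * ?w I S" for S
    using fin i by (simp, intro disjI2 prod.cong) auto
  have w0: "?w (insert i I) S = (1 - p i) * ?w I S" if "S \<in> Pow I" for S
    using fin i that by auto
  have inj: "inj_on (insert i) (Pow I)"
    using i by (auto simp: inj_on_def)
  have "bernoulli_avg p (insert i I) h
      = (\<Sum>S\<in>Pow I. ?w (insert i I) S * h S) + (\<Sum>S\<in>insert i ` Pow I. ?w (insert i I) S * h S)"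
    unfolding bernoulli_avg_def Pow_insert using fin i by (intro sum.union_disjoint) auto
  also have "(\<Sum>S\<in>insert i ` Pow I. ?w (insert i I) S * h S)
      = (\<Sum>S\<in>Pow I. p i * ?w I S * h (insert i S))"
    unfolding sum.reindex[OF inj] comp_def w1 ..
  also have "(\<Sum>S\<in>Pow I. ?w (insert i I) S * h S) = (\<Sum>S\<in>Pow I. (1 - p i) * ?w I S * h S)"
    by (rule sum.cong[OF refl]) (simp only: w0)
  finally show ?thesis
    unfolding bernoulli_avg_def by (simp add: sum.distrib[symmetric] algebra_simps)
qed

lemma bernoulli_avg_mono:
  assumes "\<And>i. i \<in> I \<Longrightarrow> 0 \<le> p i \<and> p i \<le> 1" and "\<And>S. S \<subseteq> I \<Longrightarrow> h S \<le> k S"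
  shows "bernoulli_avg p I h \<le> bernoulli_avg p I k"
  unfolding bernoulli_avg_def using assms
  by (intro sum_mono mult_left_mono prod_nonneg) auto

lemma bernoulli_avg_cong:
  "(\<And>S. S \<subseteq> I \<Longrightarrow> h S = k S) \<Longrightarrow> bernoulli_avg p I h = bernoulli_avg p I k"
  unfolding bernoulli_avg_def by (intro sum.cong) auto

lemma bernoulli_avg_add:
  "bernoulli_avg p I (\<lambda>S. h S + k S) = bernoulli_avg p I h + bernoulli_avg p I k"
  unfolding bernoulli_avg_def by (simp add: sum.distrib algebra_simps)

lemma bernoulli_avg_cmult:
  "bernoulli_avg p I (\<lambda>S. c * h S) = c * bernoulli_avg p I h"
  unfolding bernoulli_avg_def by (simp add: sum_distrib_left mult_ac)

lemma bernoulli_avg_sum: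
  "bernoulli_avg p I (\<lambda>S. \<Sum>x\<in>X. h x S) = (\<Sum>x\<in>X. bernoulli_avg p I (h x))"
  unfolding bernoulli_avg_def by (simp add: sum_distrib_left sum.swap[of _ X])

lemma bernoulli_avg_const:
  "finite I \<Longrightarrow> bernoulli_avg p I (\<lambda>S. c) = c"
  by (induction I rule: finite_induct) (simp_all add: bernoulli_avg_insert algebra_simps)

section \<open>Symmetrization and contraction\<close>

text \<open>Let \<open>t\<close> and \<open>s\<close> attain the two maxima on the left. Splitting \<open>p * g t\<close> into the fractions
  \<open>1 - p/2\<close> and \<open>p/2\<close>, and \<open>(1 - p) * g s\<close> into \<open>(1 - p)/2\<close> and \<open>1 - (1 - p)/2\<close>, distributes the
  weight so that both maxima on the right receive total weight \<open>1/2\<close>, while the terms in \<open>x\<close> add up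
  to \<open>p * (1 - p) * \<bar>x t - x s\<bar>\<close>.\<close>

lemma contraction_step:
  fixes g \<phi> x :: "'t \<Rightarrow> real"
  assumes T: "finite T" "T \<noteq> {}" and p: "0 \<le> p" "p \<le> 1"
    and lip: "\<And>s t. s \<in> T \<Longrightarrow> t \<in> T \<Longrightarrow> \<bar>\<phi> s - \<phi> t\<bar> \<le> \<bar>x s - x t\<bar>"
  shows "p * (MAX t\<in>T. g t + (1 - p) * \<phi> t) + (1 - p) * (MAX t\<in>T. g t - p * \<phi> t)
       \<le> 1/2 * (MAX t\<in>T. g t + x t) + 1/2 * (MAX t\<in>T. g t - x t)"
proof -
  define A where "A = (MAX t\<in>T. g t + x t)"
  define B where "B = (MAX t\<in>T. g t - x t)"
  have AB: "g t + x t \<le> A" "g t - x t \<le> B" if "t \<in> T" for t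
    unfolding A_def B_def using T that by auto
  obtain t where t: "t \<in> T" "(MAX t\<in>T. g t + (1 - p) * \<phi> t) = g t + (1 - p) * \<phi> t"
    using Max_in[of "(\<lambda>t. g t + (1 - p) * \<phi> t) ` T"] T by fastforce
  obtain s where s: "s \<in> T" "(MAX t\<in>T. g t - p * \<phi> t) = g s - p * \<phi> s"
    using Max_in[of "(\<lambda>t. g t - p * \<phi> t) ` T"] T by fastforce
  have c: "0 \<le> p * (1 - p / 2)" "0 \<le> p * (p / 2)" "0 \<le> (1 - p) * ((1 - p) / 2)"
    "0 \<le> (1 - p) * (1 - (1 - p) / 2)"
    using p by auto
  have q: "0 \<le> p * (1 - p)" using p by simp
  have "\<phi> t - \<phi> s \<le> \<bar>x t - x s\<bar>" using lip[OF t(1) s(1)] by linarith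
  hence "p * (1 - p) * (\<phi> t - \<phi> s) \<le> p * (1 - p) * \<bar>x t - x s\<bar>"
    using q by (rule mult_left_mono)
  hence "p * (g t + (1 - p) * \<phi> t) + (1 - p) * (g s - p * \<phi> s)
      \<le> p * g t + (1 - p) * g s + p * (1 - p) * \<bar>x t - x s\<bar>"
    by (simp add: algebra_simps)
  also have "\<dots> \<le> 1/2 * A + 1/2 * B"
  proof (cases "x t \<ge> x s")
    case True
    have "p * (1 - p / 2) * (g t + x t) \<le> p * (1 - p / 2) * A"
      "p * (p / 2) * (g t - x t) \<le> p * (p / 2) * B"
      "(1 - p) * ((1 - p) / 2) * (g s + x s) \<le> (1 - p) * ((1 - p) / 2) * A"
      "(1 - p) * (1 - (1 - p) / 2) * (g s - x s) \<le> (1 - p) * (1 - (1 - p) / 2) * B"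
      using AB[OF t(1)] AB[OF s(1)] c by (intro mult_left_mono; blast)+
    with True show ?thesis by (simp add: field_simps)
  next
    case False
    have "p * (1 - p / 2) * (g t - x t) \<le> p * (1 - p / 2) * B"
      "p * (p / 2) * (g t + x t) \<le> p * (p / 2) * A"
      "(1 - p) * ((1 - p) / 2) * (g s - x s) \<le> (1 - p) * ((1 - p) / 2) * B"
      "(1 - p) * (1 - (1 - p) / 2) * (g s + x s) \<le> (1 - p) * (1 - (1 - p) / 2) * A"
      using AB[OF t(1)] AB[OF s(1)] c by (intro mult_left_mono; blast)+
    with False show ?thesis by (simp add: field_simps)
  qed
  finally show ?thesis unfolding t(2) s(2) A_def B_def .
qed

text \<open>A sign vector is encoded by its set of positive positions, so uniform random signs are
  \<open>bernoulli_avg\<close> with all probabilities \<open>1/2\<close>.\<close>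

definition rsign :: "'i set \<Rightarrow> 'i \<Rightarrow> real" where
  "rsign S i = (if i \<in> S then 1 else -1)"

text \<open>Induction over \<open>I\<close> exchanges one centred coordinate at a time for a random
  sign by \<open>contraction_step\<close>. The exchanged coordinate joins \<open>g\<close>, which is
  therefore arbitrary, and the constant stays 1.\<close>

theorem symmetrization_contraction:
  fixes g :: "'t \<Rightarrow> real" and \<phi> x :: "'i \<Rightarrow> 't \<Rightarrow> real"
  assumes I: "finite I" and T: "finite T" "T \<noteq> {}"
    and p: "\<And>i. i \<in> I \<Longrightarrow> 0 \<le> p i \<and> p i \<le> 1"
    and lip: "\<And>i s t. i \<in> I \<Longrightarrow> s \<in> T \<Longrightarrow> t \<in> T \<Longrightarrow> \<bar>\<phi> i s - \<phi> i t\<bar> \<le> \<bar>x i s - x i t\<bar>"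
  shows "bernoulli_avg p I (\<lambda>S. MAX t\<in>T. g t + (\<Sum>i\<in>I. (of_bool (i \<in> S) - p i) * \<phi> i t))
       \<le> bernoulli_avg (\<lambda>_. 1/2) I (\<lambda>S. MAX t\<in>T. g t + (\<Sum>i\<in>I. rsign S i * x i t))"
  using I p lip
proof (induction I arbitrary: g rule: finite_induct)
  case empty
  show ?case by simp
next
  case (insert i I g)
  let ?X = "\<lambda>g S. MAX t\<in>T. g t + (\<Sum>i\<in>I. (of_bool (i \<in> S) - p i) * \<phi> i t)"
  let ?Y = "\<lambda>g S. MAX t\<in>T. g t + (\<Sum>i\<in>I. rsign S i * x i t)"
  note avg_insert = bernoulli_avg_insert[OF insert.hyps]
  \<comment> \<open>Stated for a general summand, since both the centred and the signed sums use
    it.\<close>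
  have sum_same: "(\<Sum>j\<in>I. F j (j \<in> insert i S)) = (\<Sum>j\<in>I. F j (j \<in> S))" for F :: "'i \<Rightarrow> bool \<Rightarrow> real" and S
  proof (rule sum.cong[OF refl])
    fix j assume "j \<in> I"
    hence "j \<in> insert i S \<longleftrightarrow> j \<in> S" using insert.hyps by auto
    thus "F j (j \<in> insert i S) = F j (j \<in> S)" by (simp only:)
  qed
  have X1: "(\<Sum>j\<in>insert i I. (of_bool (j \<in> insert i S) - p j) * \<phi> j t)
      = (1 - p i) * \<phi> i t + (\<Sum>j\<in>I. (of_bool (j \<in> S) - p j) * \<phi> j t)" for S t
    using insert.hyps sum_same[of "\<lambda>j b. (of_bool b - p j) * \<phi> j t"] by simp
  have X0: "(\<Sum>j\<in>insert i I. (of_bool (j \<in> S) - p j) * \<phi> j t)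
      = - p i * \<phi> i t + (\<Sum>j\<in>I. (of_bool (j \<in> S) - p j) * \<phi> j t)" if "S \<subseteq> I" for S t
    using insert.hyps that by (subst sum.insert) auto
  have Y1: "(\<Sum>j\<in>insert i I. rsign (insert i S) j * x j t)
      = x i t + (\<Sum>j\<in>I. rsign S j * x j t)" for S t
    using insert.hyps sum_same[of "\<lambda>j b. (if b then 1 else -1) * x j t"] by (simp add: rsign_def)
  have Y0: "(\<Sum>j\<in>insert i I. rsign S j * x j t)
      = - x i t + (\<Sum>j\<in>I. rsign S j * x j t)" if "S \<subseteq> I" for S t
    using insert.hyps that by (subst sum.insert) (auto simp: rsign_def)
  have "bernoulli_avg p (insert i I)
      (\<lambda>S. MAX t\<in>T. g t + (\<Sum>j\<in>insert i I. (of_bool (j \<in> S) - p j) * \<phi> j t))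
    \<le> bernoulli_avg p I (\<lambda>S. 1/2 * ?X (\<lambda>t. g t + x i t) S + 1/2 * ?X (\<lambda>t. g t - x i t) S)"
    unfolding avg_insert
  proof (rule bernoulli_avg_mono)
    fix S assume S: "S \<subseteq> I"
    \<comment> \<open>\<open>contraction_step\<close> is applied at fixed \<open>S\<close>, with the
      terms of the coordinates in \<open>I\<close> added to \<open>g\<close>.\<close>
    have "p i * (MAX t\<in>T. (g t + (\<Sum>j\<in>I. (of_bool (j \<in> S) - p j) * \<phi> j t)) + (1 - p i) * \<phi> i t)
        + (1 - p i) * (MAX t\<in>T. (g t + (\<Sum>j\<in>I. (of_bool (j \<in> S) - p j) * \<phi> j t)) - p i * \<phi> i t)
      \<le> 1/2 * (MAX t\<in>T. (g t + (\<Sum>j\<in>I. (of_bool (j \<in> S) - p j) * \<phi> j t)) + x i t)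
        + 1/2 * (MAX t\<in>T. (g t + (\<Sum>j\<in>I. (of_bool (j \<in> S) - p j) * \<phi> j t)) - x i t)"
      by (rule contraction_step[OF T]) (use insert.prems in auto)
    thus "p i * (MAX t\<in>T. g t + (\<Sum>j\<in>insert i I. (of_bool (j \<in> insert i S) - p j) * \<phi> j t))
        + (1 - p i) * (MAX t\<in>T. g t + (\<Sum>j\<in>insert i I. (of_bool (j \<in> S) - p j) * \<phi> j t))
      \<le> 1/2 * ?X (\<lambda>t. g t + x i t) S + 1/2 * ?X (\<lambda>t. g t - x i t) S"
      unfolding X1 X0[OF S] by (simp add: algebra_simps)
  qed (use insert.prems in auto)
  also have "\<dots> = 1/2 * bernoulli_avg p I (?X (\<lambda>t. g t + x i t))
      + 1/2 * bernoulli_avg p I (?X (\<lambda>t. g t - x i t))"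
    by (simp only: bernoulli_avg_add bernoulli_avg_cmult)
  also have "\<dots> \<le> 1/2 * bernoulli_avg (\<lambda>_. 1/2) I (?Y (\<lambda>t. g t + x i t))
      + 1/2 * bernoulli_avg (\<lambda>_. 1/2) I (?Y (\<lambda>t. g t - x i t))"
    using insert.prems by (intro add_mono mult_left_mono insert.IH) auto
  also have "\<dots> = bernoulli_avg (\<lambda>_. 1/2) I
      (\<lambda>S. 1/2 * ?Y (\<lambda>t. g t + x i t) S + 1/2 * ?Y (\<lambda>t. g t - x i t) S)"
    by (simp only: bernoulli_avg_add bernoulli_avg_cmult)
  also have "\<dots> = bernoulli_avg (\<lambda>_. 1/2) (insert i I)
      (\<lambda>S. MAX t\<in>T. g t + (\<Sum>j\<in>insert i I. rsign S j * x j t))"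
    unfolding avg_insert
  proof (rule bernoulli_avg_cong)
    fix S assume S: "S \<subseteq> I"
    show "1/2 * ?Y (\<lambda>t. g t + x i t) S + 1/2 * ?Y (\<lambda>t. g t - x i t) S
      = 1/2 * (MAX t\<in>T. g t + (\<Sum>j\<in>insert i I. rsign (insert i S) j * x j t))
        + (1 - 1/2) * (MAX t\<in>T. g t + (\<Sum>j\<in>insert i I. rsign S j * x j t))"
      unfolding Y1 Y0[OF S] by (simp add: algebra_simps)
  qed
  finally show ?case .
qed

section \<open>Fourth moment of a random sign matrix\<close>

text \<open>Flipping the membership of \<open>a\<close> reverses the sign and leaves
  \<open>h\<close> fixed, so the two halves of the average cancel.\<close>

lemma bernoulli_avg_rsign_mult_eq_0:
  assumes I: "finite I" "a \<in> I" and h: "\<And>S. S \<subseteq> I \<Longrightarrow> h (insert a S) = h S"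
  shows "bernoulli_avg (\<lambda>_. 1/2) I (\<lambda>S. rsign S a * h S) = 0"
proof -
  have "bernoulli_avg (\<lambda>_. 1/2) (insert a (I - {a})) (\<lambda>S. rsign S a * h S)
      = bernoulli_avg (\<lambda>_. 1/2) (I - {a})
        (\<lambda>S. 1/2 * (rsign (insert a S) a * h (insert a S)) + (1 - 1/2) * (rsign S a * h S))"
    using I by (intro bernoulli_avg_insert) auto
  also have "\<dots> = bernoulli_avg (\<lambda>_. 1/2) (I - {a}) (\<lambda>S. 0)"
    using h by (intro bernoulli_avg_cong) (auto simp: rsign_def)
  finally show ?thesis using I by (simp add: insert_absorb bernoulli_avg_const)
qed

text \<open>Expanding the squares gives products of signs at the four corners of a rectangle. Their
  mean vanishes unless the rectangle is degenerate, and there are at most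
  \<open>n * m\<^sup>2 + n\<^sup>2 * m\<close> degenerate ones.\<close>

lemma bernoulli_avg_gram_sq_le:
  "bernoulli_avg (\<lambda>_. 1/2) ({..<m} \<times> {..<n}) (\<lambda>S. gram_sq m n (\<lambda>i j. rsign S (i, j)))
     \<le> real m * real n * (real m + real n)"
proof -
  let ?I = "{..<m} \<times> {..<n}"
  let ?t = "\<lambda>j k i l S. rsign S (i, j) * rsign S (i, k) * (rsign S (l, j) * rsign S (l, k))"
  have "bernoulli_avg (\<lambda>_. 1/2) ?I (\<lambda>S. gram_sq m n (\<lambda>i j. rsign S (i, j)))
      = (\<Sum>j<n. \<Sum>k<n. \<Sum>i<m. \<Sum>l<m. bernoulli_avg (\<lambda>_. 1/2) ?I (?t j k i l))"
    unfolding gram_sq_def power2_eq_square sum_product by (simp only: bernoulli_avg_sum)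
  also have "\<dots> \<le> (\<Sum>j<n. \<Sum>k<n. \<Sum>i<m. \<Sum>l<m. of_bool (j = k) + of_bool (i = l))"
  proof (intro sum_mono)
    fix j k i l assume bnd: "j \<in> {..<n}" "k \<in> {..<n}" "i \<in> {..<m}" "l \<in> {..<m}"
    show "bernoulli_avg (\<lambda>_. 1/2) ?I (?t j k i l) \<le> of_bool (j = k) + of_bool (i = l)"
    proof (cases "j = k \<or> i = l")
      case True
      have "bernoulli_avg (\<lambda>_. 1/2) ?I (?t j k i l) \<le> bernoulli_avg (\<lambda>_. 1/2) ?I (\<lambda>_. 1)"
        by (rule bernoulli_avg_mono) (auto simp: rsign_def)
      also have "\<dots> = 1" by (rule bernoulli_avg_const) simp
      also have "1 \<le> of_bool (j = k) + (of_bool (i = l) :: real)" using True by auto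
      finally show ?thesis .
    next
      case False
      \<comment> \<open>Reassociated so that the sign at the corner \<open>(i, j)\<close> stands in
        front; the other three corners differ from it.\<close>
      have "bernoulli_avg (\<lambda>_. 1/2) ?I
          (\<lambda>S. rsign S (i, j) * (rsign S (i, k) * (rsign S (l, j) * rsign S (l, k)))) = 0"
        using bnd False by (intro bernoulli_avg_rsign_mult_eq_0) (auto simp: rsign_def)
      thus ?thesis by (simp add: mult.assoc)
    qed
  qed
  also have "\<dots> = real n * (real m * real m) + real n * (real n * real m)"
    by (simp add: sum.distrib of_bool_def distrib_left if_distrib[of "\<lambda>x. _ * x"] cong: if_cong)
  finally show ?thesis by (simp add: algebra_simps)
qed

text \<open>Concavity: the right side is the tangent of the fourth root at \<open>s ^ 4\<close>.
  Being affine in \<open>y\<close>, it can be averaged.\<close>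

lemma root4_le_tangent:
  assumes "y \<ge> 0" "s > 0"
  shows "root 4 y \<le> 3/4 * s + y / (4 * s ^ 3)"
proof -
  define x where "x = root 4 y"
  have y: "y = x ^ 4" and x: "x \<ge> 0" using assms by (simp_all add: x_def real_root_pow_pos2)
  \<comment> \<open>The polynomial \<open>x ^ 4 - 4 * s ^ 3 * x + 3 * s ^ 4\<close> has a double
    root at \<open>s\<close>.\<close>
  have "0 \<le> (x - s)\<^sup>2 * (x\<^sup>2 + 2 * x * s + 3 * s\<^sup>2)"
    using x assms by (intro mult_nonneg_nonneg add_nonneg_nonneg) auto
  also have "\<dots> = 3 * s ^ 4 + x ^ 4 - 4 * s ^ 3 * x"
    by (simp add: power2_eq_square power3_eq_cube power4_eq_xxxx algebra_simps)
  finally have "4 * s ^ 3 * x \<le> 3 * s ^ 4 + y" unfolding y by simp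
  hence "x \<le> (3 * s ^ 4 + y) / (4 * s ^ 3)"
    using assms by (simp add: pos_le_divide_eq mult.commute)
  also have "\<dots> = 3/4 * s + y / (4 * s ^ 3)"
    using assms by (simp add: field_simps eval_nat_numeral)
  finally show ?thesis unfolding x_def .
qed

text \<open>Jensen's inequality for the fourth root. With the tangent taken at the moment bound
  \<open>b\<close>, its value there is exactly \<open>s\<close>.\<close>

lemma bernoulli_avg_root4_gram_sq_le:
  "bernoulli_avg (\<lambda>_. 1/2) ({..<m} \<times> {..<n}) (\<lambda>S. root 4 (gram_sq m n (\<lambda>i j. rsign S (i, j))))
     \<le> root 4 (real m * real n * (real m + real n))"
proof (cases "m = 0 \<or> n = 0")
  \<comment> \<open>Empty matrices are treated apart, since the tangent point \<open>s\<close> would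
    be 0.\<close>
  case True
  thus ?thesis by (auto simp: gram_sq_def bernoulli_avg_const)
next
  case False
  let ?I = "{..<m} \<times> {..<n}"
  define b where "b = real m * real n * (real m + real n)"
  define s where "s = root 4 b"
  have b: "b > 0" using False by (simp add: b_def)
  hence s: "s > 0" and s4: "s ^ 4 = b" by (simp_all add: s_def real_root_pow_pos2)
  have "bernoulli_avg (\<lambda>_. 1/2) ?I (\<lambda>S. root 4 (gram_sq m n (\<lambda>i j. rsign S (i, j))))
      \<le> bernoulli_avg (\<lambda>_. 1/2) ?I
        (\<lambda>S. 3/4 * s + 1 / (4 * s ^ 3) * gram_sq m n (\<lambda>i j. rsign S (i, j)))"
    using root4_le_tangent[OF _ s]
    by (intro bernoulli_avg_mono) (auto simp: gram_sq_def sum_nonneg)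
  also have "\<dots> = 3/4 * s + 1 / (4 * s ^ 3) *
      bernoulli_avg (\<lambda>_. 1/2) ?I (\<lambda>S. gram_sq m n (\<lambda>i j. rsign S (i, j)))"
    by (simp only: bernoulli_avg_add bernoulli_avg_cmult bernoulli_avg_const
        finite_cartesian_product finite_lessThan)
  also have "\<dots> \<le> 3/4 * s + 1 / (4 * s ^ 3) * b"
    using bernoulli_avg_gram_sq_le[of m n] s unfolding b_def
    by (intro add_left_mono mult_left_mono) auto
  also have "\<dots> = s"
    unfolding s4[symmetric] using s by (simp add: field_simps eval_nat_numeral)
  finally show ?thesis unfolding s_def b_def .
qed

section \<open>Weighted square error\<close>

text \<open>\<open>D S\<close> stands for the estimation error when \<open>S\<close> is revealed,
  and \<open>K\<close> for a bound on its nuclear norm in dual form. Symmetrization and contraction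
  reduce the squares to pairings with random signs.\<close>

theorem bernoulli_avg_weighted_square_le:
  fixes D :: "(nat \<times> nat) set \<Rightarrow> nat \<times> nat \<Rightarrow> real"
  defines "I \<equiv> \<lambda>m n. {..<m} \<times> {..<n}"
  assumes p: "\<And>i. i \<in> I m n \<Longrightarrow> 0 \<le> p i \<and> p i \<le> 1"
    and D_obs: "\<And>S i. S \<subseteq> I m n \<Longrightarrow> i \<in> S \<Longrightarrow> D S i = 0"
    and D_le: "\<And>S i. S \<subseteq> I m n \<Longrightarrow> i \<in> I m n \<Longrightarrow> \<bar>D S i\<bar> \<le> 2"
    and K: "\<And>S E. S \<subseteq> I m n \<Longrightarrow> \<bar>\<Sum>i<m. \<Sum>j<n. E i j * D S (i, j)\<bar> \<le> root 4 (gram_sq m n E) * K"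
    and K0: "K \<ge> 0"
  shows "bernoulli_avg p (I m n) (\<lambda>S. \<Sum>i\<in>I m n. p i * (D S i)\<^sup>2)
       \<le> 4 * K * root 4 (real m * real n * (real m + real n))"
proof -
  let ?I = "I m n"
  have fin: "finite ?I" by (simp add: I_def)
  \<comment> \<open>The maximum over all sets \<open>S'\<close> decouples the error from the
    revealed set. The summand 0 is the function \<open>g\<close> of
    \<open>symmetrization_contraction\<close>.\<close>
  have "bernoulli_avg p ?I (\<lambda>S. \<Sum>i\<in>?I. p i * (D S i)\<^sup>2)
      \<le> bernoulli_avg p ?I (\<lambda>S. MAX S'\<in>Pow ?I. 0 + (\<Sum>i\<in>?I. (of_bool (i \<in> S) - p i) * - (D S' i)\<^sup>2))"
  proof (rule bernoulli_avg_mono[OF p])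
    fix S assume S: "S \<subseteq> ?I"
    \<comment> \<open>The error vanishes on \<open>S\<close>, so the indicator of \<open>S\<close>
      can be inserted without changing the sum.\<close>
    have "(\<Sum>i\<in>?I. p i * (D S i)\<^sup>2) = 0 + (\<Sum>i\<in>?I. (of_bool (i \<in> S) - p i) * - (D S i)\<^sup>2)"
      using D_obs[OF S] by (simp, intro sum.cong) auto
    also have "\<dots> \<le> (MAX S'\<in>Pow ?I. 0 + (\<Sum>i\<in>?I. (of_bool (i \<in> S) - p i) * - (D S' i)\<^sup>2))"
      using fin S by (intro Max_ge) auto
    finally show "(\<Sum>i\<in>?I. p i * (D S i)\<^sup>2) \<le> \<dots>" .
  qed
  also have "\<dots> \<le> bernoulli_avg (\<lambda>_. 1/2) ?I
      (\<lambda>S. MAX S'\<in>Pow ?I. 0 + (\<Sum>i\<in>?I. rsign S i * (4 * D S' i)))"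
  proof (rule symmetrization_contraction[OF fin _ _ p])
    fix i S S' assume a: "i \<in> ?I" "S \<in> Pow ?I" "S' \<in> Pow ?I"
    \<comment> \<open>On \<open>[-2, 2]\<close> the square has Lipschitz constant 4; the factor is
      carried by \<open>4 * D\<close>.\<close>
    have "\<bar>- (D S i)\<^sup>2 - - (D S' i)\<^sup>2\<bar> = \<bar>D S i + D S' i\<bar> * \<bar>D S i - D S' i\<bar>"
      unfolding abs_mult[symmetric] by (simp add: power2_eq_square algebra_simps abs_minus_commute)
    also have "\<dots> \<le> 4 * \<bar>D S i - D S' i\<bar>"
      using D_le[of S i] D_le[of S' i] a by (intro mult_right_mono) auto
    also have "\<dots> = \<bar>4 * D S i - 4 * D S' i\<bar>"
      unfolding right_diff_distrib[symmetric] abs_mult by simp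
    finally show "\<bar>- (D S i)\<^sup>2 - - (D S' i)\<^sup>2\<bar> \<le> \<bar>4 * D S i - 4 * D S' i\<bar>" .
  qed (use fin in auto)
  also have "\<dots> \<le> bernoulli_avg (\<lambda>_. 1/2) ?I
      (\<lambda>S. 4 * K * root 4 (gram_sq m n (\<lambda>i j. rsign S (i, j))))"
  proof (rule bernoulli_avg_mono)
    fix S
    show "(MAX S'\<in>Pow ?I. 0 + (\<Sum>i\<in>?I. rsign S i * (4 * D S' i)))
        \<le> 4 * K * root 4 (gram_sq m n (\<lambda>i j. rsign S (i, j)))"
    proof (rule Max.boundedI)
      fix a assume "a \<in> (\<lambda>S'. 0 + (\<Sum>i\<in>?I. rsign S i * (4 * D S' i))) ` Pow ?I"
      then obtain S' where S': "S' \<subseteq> ?I" and a: "a = (\<Sum>i\<in>?I. rsign S i * (4 * D S' i))" by auto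
      have "a = 4 * (\<Sum>i<m. \<Sum>j<n. rsign S (i, j) * D S' (i, j))"
        unfolding a I_def by (simp add: sum.cartesian_product sum_distrib_left mult_ac case_prod_unfold)
      also have "\<dots> \<le> 4 * (root 4 (gram_sq m n (\<lambda>i j. rsign S (i, j))) * K)"
        using K[OF S', of "\<lambda>i j. rsign S (i, j)"] by simp
      finally show "a \<le> 4 * K * root 4 (gram_sq m n (\<lambda>i j. rsign S (i, j)))" by (simp add: mult_ac)
    qed (use fin in auto)
  qed auto
  also have "\<dots> = 4 * K * bernoulli_avg (\<lambda>_. 1/2) ?I
      (\<lambda>S. root 4 (gram_sq m n (\<lambda>i j. rsign S (i, j))))"
    by (rule bernoulli_avg_cmult)
  also have "\<dots> \<le> 4 * K * root 4 (real m * real n * (real m + real n))"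
    unfolding I_def using K0 by (intro mult_left_mono bernoulli_avg_root4_gram_sq_le) auto
  finally show ?thesis .
qed

section \<open>Consistency\<close>

text \<open>Independence speaks of intersections of the events themselves. Complements enter one by
  one, by subtracting the part where \<open>y\<close> is revealed; this moves \<open>y\<close> into
  \<open>X\<close>, so \<open>X\<close> varies in the induction.\<close>

lemma (in prob_space) prob_indep_events_pattern:
  assumes indep: "indep_events (\<lambda>i. {\<omega> \<in> space M. i \<in> R \<omega>}) I"
    and p: "\<And>i. i \<in> I \<Longrightarrow> prob {\<omega> \<in> space M. i \<in> R \<omega>} = p i"
    and Y: "finite Y" and X: "finite X" and sub: "X \<subseteq> I" "Y \<subseteq> I" "X \<inter> Y = {}"
  shows "prob {\<omega> \<in> space M. X \<subseteq> R \<omega> \<and> Y \<inter> R \<omega> = {}} = (\<Prod>i\<in>X. p i) * (\<Prod>i\<in>Y. 1 - p i)"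
  using Y X sub
proof (induction Y arbitrary: X rule: finite_induct)
  case empty
  show ?case
  proof (cases "X = {}")
    \<comment> \<open>Independence is stated for nonempty subfamilies, so the empty intersection,
      the whole space, is treated apart.\<close>
    case True
    thus ?thesis by (simp add: prob_space)
  next
    case False
    have "{\<omega> \<in> space M. X \<subseteq> R \<omega> \<and> {} \<inter> R \<omega> = {}} = (\<Inter>i\<in>X. {\<omega> \<in> space M. i \<in> R \<omega>})"
      using False by auto
    moreover have "prob (\<Inter>i\<in>X. {\<omega> \<in> space M. i \<in> R \<omega>}) = (\<Prod>i\<in>X. prob {\<omega> \<in> space M. i \<in> R \<omega>})"
      using indep False empty unfolding indep_events_def by blast
    moreover have "\<dots> = (\<Prod>i\<in>X. p i)" using p empty by (intro prod.cong) auto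
    ultimately show ?thesis by simp
  qed
next
  case (insert y Y X)
  have [measurable]: "{\<omega> \<in> space M. i \<in> R \<omega>} \<in> events" if "i \<in> I" for i
    using indep that unfolding indep_events_def by auto
  have meas: "{\<omega> \<in> space M. Z \<subseteq> R \<omega> \<and> Y \<inter> R \<omega> = {}} \<in> events" if "finite Z" "Z \<subseteq> I" for Z
  proof -
    have "{\<omega> \<in> space M. (\<forall>i\<in>Z. i \<in> R \<omega>) \<and> (\<forall>i\<in>Y. \<not> i \<in> R \<omega>)} \<in> events"
      using that insert
      by (intro sets.sets_Collect_conj sets.sets_Collect_finite_All sets.sets_Collect_neg) auto
    moreover have "{\<omega> \<in> space M. (\<forall>i\<in>Z. i \<in> R \<omega>) \<and> (\<forall>i\<in>Y. \<not> i \<in> R \<omega>)}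
        = {\<omega> \<in> space M. Z \<subseteq> R \<omega> \<and> Y \<inter> R \<omega> = {}}" by auto
    ultimately show ?thesis by simp
  qed
  have split: "{\<omega> \<in> space M. X \<subseteq> R \<omega> \<and> insert y Y \<inter> R \<omega> = {}}
      = {\<omega> \<in> space M. X \<subseteq> R \<omega> \<and> Y \<inter> R \<omega> = {}} - {\<omega> \<in> space M. insert y X \<subseteq> R \<omega> \<and> Y \<inter> R \<omega> = {}}"
    by auto
  have "prob {\<omega> \<in> space M. X \<subseteq> R \<omega> \<and> insert y Y \<inter> R \<omega> = {}}
      = prob {\<omega> \<in> space M. X \<subseteq> R \<omega> \<and> Y \<inter> R \<omega> = {}}
      - prob {\<omega> \<in> space M. insert y X \<subseteq> R \<omega> \<and> Y \<inter> R \<omega> = {}}"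
    unfolding split using insert.prems by (intro finite_measure_Diff meas) auto
  also have "prob {\<omega> \<in> space M. X \<subseteq> R \<omega> \<and> Y \<inter> R \<omega> = {}} = (\<Prod>i\<in>X. p i) * (\<Prod>i\<in>Y. 1 - p i)"
    by (rule insert.IH[OF insert.prems(1,2)]) (use insert.prems in blast)+
  also have "prob {\<omega> \<in> space M. insert y X \<subseteq> R \<omega> \<and> Y \<inter> R \<omega> = {}}
      = (\<Prod>i\<in>insert y X. p i) * (\<Prod>i\<in>Y. 1 - p i)"
  proof (rule insert.IH)
    show "finite (insert y X)" using insert.prems(1) by simp
    show "insert y X \<subseteq> I" "Y \<subseteq> I" using insert.prems by blast+
    show "insert y X \<inter> Y = {}" using insert.prems(4) insert.hyps(2) by blast
  qed
  also have "(\<Prod>i\<in>insert y X. p i) = p y * (\<Prod>i\<in>X. p i)"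
    using insert.prems(1,4) by (subst prod.insert) auto
  finally show ?case using insert.hyps by (simp add: algebra_simps)
qed

text \<open>\<open>R \<omega> \<inter> I\<close> takes finitely many values, each with probability
  equal to its weight in \<open>bernoulli_avg\<close>.\<close>

lemma (in prob_space) expectation_indep_events:
  assumes I: "finite I" and indep: "indep_events (\<lambda>i. {\<omega> \<in> space M. i \<in> R \<omega>}) I"
    and p: "\<And>i. i \<in> I \<Longrightarrow> prob {\<omega> \<in> space M. i \<in> R \<omega>} = p i"
  shows "expectation (\<lambda>\<omega>. h (R \<omega> \<inter> I)) = bernoulli_avg p I h"
proof -
  define A where "A S = {\<omega> \<in> space M. R \<omega> \<inter> I = S}" for S
  have A_alt: "A S = {\<omega> \<in> space M. (\<forall>i\<in>S. i \<in> R \<omega>) \<and> (\<forall>i\<in>I - S. \<not> i \<in> R \<omega>)}"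
    if "S \<subseteq> I" for S using that unfolding A_def by auto
  have ev: "{\<omega> \<in> space M. i \<in> R \<omega>} \<in> events" if "i \<in> I" for i
    using indep that unfolding indep_events_def by auto
  have A: "A S \<in> events" if S: "S \<subseteq> I" for S
    unfolding A_alt[OF S] using finite_subset[OF S I] I S ev
    by (intro sets.sets_Collect_conj sets.sets_Collect_finite_All sets.sets_Collect_neg) auto
  have prob_A: "prob (A S) = (\<Prod>i\<in>I. if i \<in> S then p i else 1 - p i)" if S: "S \<subseteq> I" for S
  proof -
    have "A S = {\<omega> \<in> space M. S \<subseteq> R \<omega> \<and> (I - S) \<inter> R \<omega> = {}}" unfolding A_alt[OF S] by auto
    hence "prob (A S) = (\<Prod>i\<in>S. p i) * (\<Prod>i\<in>I - S. 1 - p i)"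
      using prob_indep_events_pattern[OF indep p, of "I - S" S] finite_subset[OF S I] I S by auto
    also have "\<dots> = (\<Prod>i\<in>I. if i \<in> S then p i else 1 - p i)"
      using I S by (simp add: prod.If_cases Int_absorb1 Diff_eq)
    finally show ?thesis .
  qed
  \<comment> \<open>The integrand is a simple function over the atoms \<open>A S\<close>, which are
    events because finitely many events determine them.\<close>
  have "expectation (\<lambda>\<omega>. h (R \<omega> \<inter> I)) = expectation (\<lambda>\<omega>. \<Sum>S\<in>Pow I. h S * indicator (A S) \<omega>)"
  proof (rule Bochner_Integration.integral_cong[OF refl])
    fix \<omega> assume \<omega>: "\<omega> \<in> space M"
    have "(\<Sum>S\<in>Pow I. h S * indicator (A S) \<omega>) = (\<Sum>S\<in>Pow I. if S = R \<omega> \<inter> I then h S else 0)"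
      using \<omega> by (intro sum.cong) (auto simp: A_def indicator_def)
    also have "\<dots> = h (R \<omega> \<inter> I)" using I by (simp add: sum.delta)
    finally show "h (R \<omega> \<inter> I) = (\<Sum>S\<in>Pow I. h S * indicator (A S) \<omega>)" ..
  qed
  also have "\<dots> = (\<Sum>S\<in>Pow I. h S * prob (A S))"
    using A by (subst Bochner_Integration.integral_sum) (auto simp: emeasure_eq_measure)
  finally show ?thesis
    unfolding bernoulli_avg_def using prob_A by (simp add: mult.commute)
qed

section \<open>Weak limits and small reveal probabilities\<close>

text \<open>If it failed, mass above \<open>\<epsilon>\<close> would stay below every threshold
  along a subsequence with a weak limit. In a Skorohod coupling \<open>g\<close> at the approximants
  tends almost surely to its nonzero value at the limit, while the thresholds tend to 0.\<close>

lemma weak_limits_prob_small_values: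
  fixes \<mu> :: "nat \<Rightarrow> real measure" and X :: "nat \<Rightarrow> real set" and f :: "real \<Rightarrow> real"
  assumes rd: "\<And>k. k \<ge> k0 \<Longrightarrow> real_distribution (\<mu> k)"
    and supp: "\<And>k. k \<ge> k0 \<Longrightarrow> AE x in \<mu> k. x \<in> X k"
    and XM: "\<And>k. X k \<subseteq> \<M>" and M: "\<M> \<subseteq> {-1..1}"
    and limits: "\<And>\<nu>. subseq_weak_limit \<mu> \<nu> \<Longrightarrow>
      \<exists>g. (\<forall>x\<in>\<M>. g x = f x) \<and> g \<in> borel_measurable (restrict_space borel {-1..1}) \<and>
          g ` {-1..1} \<subseteq> {0..1::real} \<and> (AE x in \<nu>. g x \<noteq> 0 \<and> continuous (at x within {-1..1}) g)"
    and \<epsilon>: "\<epsilon> > 0"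
  shows "\<exists>\<delta>>0. \<forall>\<^sub>F k in sequentially. measure (\<mu> k) {x \<in> X k. f x < \<delta>} \<le> \<epsilon>"
proof (rule ccontr)
  \<comment> \<open>Failure at the threshold \<open>1 / (l + 1)\<close>. The witnesses
    \<open>s l\<close> are chosen strictly increasing below, so that they form a
    subsequence.\<close>
  define Q where "Q l k \<longleftrightarrow> k \<ge> k0 \<and> measure (\<mu> k) {x \<in> X k. f x < 1 / real (Suc l)} > \<epsilon>" for l k
  assume neg: "\<not> ?thesis"
  have ex: "\<exists>k>N. Q l k" for l N
  proof -
    have "\<not> (\<forall>\<^sub>F k in sequentially. measure (\<mu> k) {x \<in> X k. f x < 1 / real (Suc l)} \<le> \<epsilon>)"
    proof
      assume "\<forall>\<^sub>F k in sequentially. measure (\<mu> k) {x \<in> X k. f x < 1 / real (Suc l)} \<le> \<epsilon>"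
      hence "\<exists>\<delta>>0. \<forall>\<^sub>F k in sequentially. measure (\<mu> k) {x \<in> X k. f x < \<delta>} \<le> \<epsilon>"
        by (intro exI[of _ "1 / real (Suc l)"] conjI) simp_all
      with neg show False ..
    qed
    then obtain k where "k \<ge> max k0 (Suc N)" "\<not> measure (\<mu> k) {x \<in> X k. f x < 1 / real (Suc l)} \<le> \<epsilon>"
      unfolding eventually_sequentially by blast
    thus ?thesis unfolding Q_def by (intro exI[of _ k]) auto
  qed
  obtain s where s: "\<And>l. Q l (s l)" "\<And>l. s l < s (Suc l)"
    using dependent_nat_choice[of Q "\<lambda>l k k'. k < k'"] ex by blast
  have s_mono: "strict_mono s" using s(2) by (simp add: strict_mono_Suc_iff)
  have sk0: "s l \<ge> k0" for l using s(1) by (simp add: Q_def)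
  define \<mu>' where "\<mu>' = \<mu> \<circ> s"
  have rd': "real_distribution (\<mu>' l)" for l unfolding \<mu>'_def using rd sk0 by simp
  have AE': "AE x in \<mu>' l. x \<in> {-1..1}" for l
  proof -
    have "AE x in \<mu>' l. x \<in> X (s l)" unfolding \<mu>'_def comp_def by (rule supp[OF sk0])
    moreover have "X (s l) \<subseteq> {-1..1}" using XM M by blast
    ultimately show ?thesis by (metis (mono_tags, lifting) eventually_mono subsetD)
  qed
  have "tight \<mu>'"
    unfolding tight_def
  proof (intro conjI allI impI)
    show "real_distribution (\<mu>' l)" for l by (rule rd')
    fix e :: real assume e: "e > 0"
    \<comment> \<open>The intervals in \<open>tight\<close> are open on the left; the end -2 keeps
      the point -1 inside.\<close>
    have "measure (\<mu>' l) {-2<..1} = 1" for l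
    proof -
      interpret real_distribution "\<mu>' l" by (rule rd')
      have "AE x in \<mu>' l. x \<in> {-2<..1}" using AE' by eventually_elim auto
      thus ?thesis by (subst prob_eq_1) auto
    qed
    thus "\<exists>a b. a < b \<and> (\<forall>l. 1 - e < measure (\<mu>' l) {a<..b})"
      using e by (intro exI[of _ "-2"] exI[of _ 1]) auto
  qed
  from tight_imp_convergent_subsubsequence[OF this strict_mono_id]
  obtain r \<nu> where r: "strict_mono r" and \<nu>: "real_distribution \<nu>"
    and conv: "weak_conv_m (\<mu>' \<circ> r) \<nu>" by auto
  have "subseq_weak_limit \<mu> \<nu>"
    unfolding subseq_weak_limit_def
  proof (intro conjI exI)
    show "strict_mono (s \<circ> r)" using s_mono r by (rule strict_mono_o)
    show "weak_conv_m (\<lambda>k. \<mu> ((s \<circ> r) k)) \<nu>" using conv by (simp add: \<mu>'_def comp_def)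
  qed (rule \<nu>)
  from limits[OF this] obtain g where gf: "\<And>x. x \<in> \<M> \<Longrightarrow> g x = f x"
    and gm: "g \<in> borel_measurable (restrict_space borel {-1..1})"
    and g01: "g ` {-1..1} \<subseteq> {0..1}"
    and gae: "AE x in \<nu>. g x \<noteq> 0 \<and> continuous (at x within {-1..1}) g" by blast
  \<comment> \<open>\<open>g\<close> is measurable on \<open>[-1, 1]\<close>; extension by zero
    makes it a Borel function on the line.\<close>
  define G where "G x = indicator {-1..1} x * g x" for x :: real
  have [measurable]: "G \<in> borel_measurable borel"
    using gm unfolding G_def by (subst (asm) borel_measurable_restrict_space_iff) auto
  obtain \<Omega> :: "real measure" and Y :: "nat \<Rightarrow> real \<Rightarrow> real" and Z :: "real \<Rightarrow> real"
    where \<Omega>: "prob_space \<Omega>" and Y[measurable]: "\<And>l. Y l \<in> borel_measurable \<Omega>"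
      and dY: "\<And>l. distr \<Omega> borel (Y l) = \<mu>' (r l)"
      and Z: "Z \<in> borel_measurable \<Omega>" and dZ: "distr \<Omega> borel Z = \<nu>"
      and YZ: "\<And>\<omega>. \<omega> \<in> space \<Omega> \<Longrightarrow> (\<lambda>l. Y l \<omega>) \<longlonglongrightarrow> Z \<omega>"
    using Skorohod[of "\<mu>' \<circ> r" \<nu>] rd' \<nu> conv by force
  interpret prob_space \<Omega> by (rule \<Omega>)
  define B where "B l = {\<omega> \<in> space \<Omega>. G (Y l \<omega>) < 1 / real (Suc (r l))}" for l
  have B[measurable]: "B l \<in> events" for l unfolding B_def by measurable
  have prob_B: "prob (B l) > \<epsilon>" for l
  proof -
    let ?F = "{x \<in> X (s (r l)). f x < 1 / real (Suc (r l))}"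
    interpret D: real_distribution "\<mu>' (r l)" by (rule rd')
    have "\<epsilon> < measure (\<mu>' (r l)) ?F" using s(1)[of "r l"] by (simp add: Q_def \<mu>'_def)
    \<comment> \<open>On the entries \<open>f\<close> agrees with \<open>G\<close>, whose sublevel
      set is Borel and can be pulled back along \<open>Y\<close>.\<close>
    also have "\<dots> \<le> measure (\<mu>' (r l)) {x. G x < 1 / real (Suc (r l))}"
    proof (rule D.finite_measure_mono)
      show "?F \<subseteq> {x. G x < 1 / real (Suc (r l))}"
      proof
        fix x assume x: "x \<in> ?F"
        hence "x \<in> \<M>" using XM by blast
        moreover from this have "x \<in> {-1..1}" using M by blast
        ultimately show "x \<in> {x. G x < 1 / real (Suc (r l))}"
          using x gf by (simp add: G_def)
      qed
      have "{x. G x < 1 / real (Suc (r l))} \<in> sets borel" by measurable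
      thus "{x. G x < 1 / real (Suc (r l))} \<in> D.events" by simp
    qed
    also have "\<dots> = prob (B l)"
      unfolding dY[symmetric] B_def by (subst measure_distr) (auto intro!: arg_cong[where f=prob])
    finally show ?thesis .
  qed
  have "(\<lambda>l. prob (B l)) \<longlonglongrightarrow> 0"
  proof -
    have "AE \<omega> in \<Omega>. \<forall>l. Y l \<omega> \<in> {-1..1}"
      unfolding AE_all_countable
    proof
      fix l
      have "AE x in distr \<Omega> borel (Y l). x \<in> {-1..1}" unfolding dY by (rule AE')
      thus "AE \<omega> in \<Omega>. Y l \<omega> \<in> {-1..1}" by (rule AE_distrD[OF Y])
    qed
    moreover have "AE \<omega> in \<Omega>. g (Z \<omega>) \<noteq> 0 \<and> continuous (at (Z \<omega>) within {-1..1}) g"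
      by (rule AE_distrD[OF Z]) (unfold dZ, rule gae)
    ultimately have lim: "AE \<omega> in \<Omega>. (\<lambda>l. indicator (B l) \<omega> :: real) \<longlonglongrightarrow> 0"
      using AE_space
    proof eventually_elim
      case (elim \<omega>)
      have Yl: "Y l \<omega> \<in> {-1..1}" for l using elim by blast
      have lim: "(\<lambda>l. Y l \<omega>) \<longlonglongrightarrow> Z \<omega>" using elim by (intro YZ) auto
      \<comment> \<open>The limit stays in the closed interval, where \<open>g\<close> is
        nonnegative and continuity relative to the interval applies.\<close>
      have Z01: "Z \<omega> \<in> {-1..1}"
        by (rule closed_sequentially[OF closed_atLeastAtMost _ lim]) (use Yl in blast)
      have gYZ: "(\<lambda>l. g (Y l \<omega>)) \<longlonglongrightarrow> g (Z \<omega>)"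
        using elim by (intro continuous_within_tendsto_compose'[OF _ _ lim]) auto
      have r0: "(\<lambda>l. 1 / real (Suc (r l))) \<longlonglongrightarrow> 0"
        using LIMSEQ_subseq_LIMSEQ[OF LIMSEQ_Suc[OF lim_1_over_n] r] by (simp add: comp_def)
      have gZ: "g (Z \<omega>) > 0" using elim Z01 g01 by force
      \<comment> \<open>Half of \<open>g (Z \<omega>)\<close> eventually separates the thresholds
        from \<open>g (Y l \<omega>)\<close>, so \<open>\<omega>\<close> lies in only finitely many
        \<open>B l\<close>.\<close>
      have "\<forall>\<^sub>F l in sequentially. 1 / real (Suc (r l)) < g (Z \<omega>) / 2"
        by (rule order_tendstoD(2)[OF r0]) (use gZ in simp)
      moreover have "\<forall>\<^sub>F l in sequentially. g (Z \<omega>) / 2 < g (Y l \<omega>)"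
        by (rule order_tendstoD(1)[OF gYZ]) (use gZ in simp)
      ultimately have "\<forall>\<^sub>F l in sequentially. 1 / real (Suc (r l)) < g (Y l \<omega>)"
        by eventually_elim linarith
      hence "\<forall>\<^sub>F l in sequentially. indicator (B l) \<omega> = (0 :: real)"
        by eventually_elim (use Yl in \<open>simp add: B_def G_def\<close>)
      thus ?case by (rule tendsto_eventually)
    qed
    have "(\<lambda>l. expectation (indicator (B l) :: real \<Rightarrow> real)) \<longlonglongrightarrow> expectation (\<lambda>_. 0)"
    proof (rule integral_dominated_convergence[where w="\<lambda>_. 1", OF _ _ _ lim])
      show "AE \<omega> in \<Omega>. norm (indicator (B l) \<omega> :: real) \<le> 1" for l
        by (rule AE_I2) (simp add: indicator_def)
    qed simp_all
    thus ?thesis by simp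
  qed
  hence "\<forall>\<^sub>F l in sequentially. prob (B l) < \<epsilon>" using \<epsilon> by (rule order_tendstoD)
  then obtain l where "prob (B l) < \<epsilon>" unfolding eventually_sequentially by blast
  with prob_B[of l] show False by simp
qed

section \<open>Empirical distribution of the entries\<close>

lemma
  assumes A: "A \<in> carrier_mat m n" and mn: "m > 0" "n > 0"
  shows real_distribution_empirical: "real_distribution (empirical_distribution A)"
    and AE_empirical: "AE x in empirical_distribution A. x \<in> (\<lambda>ij. A $$ ij) ` entries A"
    and measure_empirical: "measure (empirical_distribution A) {x \<in> (\<lambda>ij. A $$ ij) ` entries A. Q x}
      = real (card {ij \<in> entries A. Q (A $$ ij)}) / (real m * real n)"
proof -
  let ?U = "uniform_count_measure (entries A)"
  have ent: "entries A = {..<m} \<times> {..<n}" using A by (simp add: entries_def)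
  have fin: "finite (entries A)" and ne: "entries A \<noteq> {}" and card: "card (entries A) = m * n"
    using mn by (auto simp: ent)
  interpret U: prob_space ?U using fin ne by (rule prob_space_uniform_count_measure)
  have meas: "(\<lambda>ij. A $$ ij) \<in> borel_measurable ?U"
    by (auto simp: measurable_def sets_uniform_count_measure space_uniform_count_measure)
  interpret E: prob_space "empirical_distribution A"
    unfolding empirical_distribution_def using meas by (rule U.prob_space_distr)
  show "real_distribution (empirical_distribution A)"
    by unfold_locales (simp_all add: empirical_distribution_def)
  \<comment> \<open>A set of entry values is finite, hence closed and Borel, whatever
    \<open>Q\<close> is.\<close>
  have fb: "S \<in> sets borel" if "S \<subseteq> (\<lambda>ij. A $$ ij) ` entries A" for S :: "real set"
    using that fin by (meson borel_closed finite_imageI finite_imp_closed finite_subset)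
  show "AE x in empirical_distribution A. x \<in> (\<lambda>ij. A $$ ij) ` entries A"
    unfolding empirical_distribution_def
    using fb by (subst AE_distr_iff[OF meas]) (auto intro!: AE_I2 simp: space_uniform_count_measure)
  have "measure (empirical_distribution A) {x \<in> (\<lambda>ij. A $$ ij) ` entries A. Q x}
      = measure ?U ((\<lambda>ij. A $$ ij) -` {x \<in> (\<lambda>ij. A $$ ij) ` entries A. Q x} \<inter> space ?U)"
    unfolding empirical_distribution_def by (rule measure_distr[OF meas]) (auto intro: fb)
  also have "(\<lambda>ij. A $$ ij) -` {x \<in> (\<lambda>ij. A $$ ij) ` entries A. Q x} \<inter> space ?U
      = {ij \<in> entries A. Q (A $$ ij)}"
    by (auto simp: space_uniform_count_measure)
  also have "measure ?U \<dots> = real (card {ij \<in> entries A. Q (A $$ ij)}) / (real m * real n)"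
    using fin by (subst measure_uniform_count_measure) (auto simp: card)
  finally show "measure (empirical_distribution A) {x \<in> (\<lambda>ij. A $$ ij) ` entries A. Q x}
      = real (card {ij \<in> entries A. Q (A $$ ij)}) / (real m * real n)" .
qed

section \<open>Error bound at fixed dimensions\<close>

text \<open>Allows \<open>R \<omega>\<close> to be replaced by a subset of the finite set of
  entries.\<close>

lemma observed_Int_entries: "observed A (\<Omega> \<inter> entries A) = observed A \<Omega>"
proof -
  have "entries A \<inter> (\<Omega> \<inter> entries A) = entries A \<inter> \<Omega>" by blast
  thus ?thesis by (simp only: observed_def)
qed

text \<open>\<open>A\<close> is feasible for its own data, so the minimum cannot exceed its nuclear
  norm.\<close>

lemma nuclear_norm_estimate_le:
  assumes A: "A \<in> carrier_mat m n"
    and bnd: "\<And>i j. i < m \<Longrightarrow> j < n \<Longrightarrow> \<bar>A $$ (i, j)\<bar> \<le> 1"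
    and est: "is_candes_recht_estimate m n (observed A \<Omega>) Z"
  shows "nuclear_norm Z \<le> nuclear_norm A"
proof -
  have "candes_recht_feasible m n (observed A \<Omega>) A"
    using A bnd unfolding candes_recht_feasible_def
    by (auto simp: observed_def restrict_map_def split: if_splits)
  thus ?thesis
    using est unfolding is_candes_recht_estimate_def is_arg_min_def by (meson not_less)
qed

text \<open>Entries with \<open>f\<close> below \<open>\<delta>\<close> contribute at most
  \<open>2\<^sup>2 = 4\<close> each; on the others the factor \<open>p / \<delta>\<close> is at
  least 1, and the weighted square sum is under control.\<close>

lemma estimation_error_le:
  fixes A :: "real mat" and f :: "real \<Rightarrow> real"
  assumes A: "A \<in> carrier_mat m n" and mn: "m > 0" "n > 0"
    and bnd: "\<And>i j. i < m \<Longrightarrow> j < n \<Longrightarrow> \<bar>A $$ (i, j)\<bar> \<le> 1"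
    and f: "\<And>ij. ij \<in> entries A \<Longrightarrow> f (A $$ ij) \<in> {0..1}"
    and P: "prob_space P" and reveal: "reveals_independently P R A f"
    and est: "\<And>\<Omega>. \<Omega> \<subseteq> entries A \<Longrightarrow>
      is_candes_recht_estimate m n (observed A \<Omega>) (Ahat (observed A \<Omega>))"
    and rank: "mat_rank A \<le> r" and \<delta>: "\<delta> > 0"
  shows "prob_space.expectation P (\<lambda>\<omega>. 1 / (real m * real n) *
      (\<Sum>i<m. \<Sum>j<n. (Ahat (observed A (R \<omega>)) $$ (i, j) - A $$ (i, j))\<^sup>2))
    \<le> 4 * (real (card {ij \<in> entries A. f (A $$ ij) < \<delta>}) / (real m * real n))
      + 8 * sqrt r / \<delta> * root 4 (1 / real m + 1 / real n)"
proof -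
  interpret P: prob_space P by (rule P)
  let ?I = "entries A"
  define N where "N = real m * real n"
  have N: "N > 0" using mn by (simp add: N_def)
  have ent: "?I = {..<m} \<times> {..<n}" using A by (simp add: entries_def)
  have fin: "finite ?I" by (simp add: ent)
  define p where "p ij = f (A $$ ij)" for ij
  have p01: "0 \<le> p ij \<and> p ij \<le> 1" if "ij \<in> ?I" for ij using f[OF that] by (simp add: p_def)
  define D where "D S ij = Ahat (observed A S) $$ ij - A $$ ij" for S ij
  have feas: "candes_recht_feasible m n (observed A S) (Ahat (observed A S))" if "S \<subseteq> ?I" for S
    using est[OF that] unfolding is_candes_recht_estimate_def is_arg_min_def by simp
  have D_obs: "D S ij = 0" if "S \<subseteq> ?I" "ij \<in> S" for S ij
  proof -
    have "observed A S ij = Some (A $$ ij)" using that by (auto simp: observed_def restrict_map_def)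
    hence "Ahat (observed A S) $$ ij = A $$ ij"
      using feas[OF that(1)] unfolding candes_recht_feasible_def by blast
    thus ?thesis by (simp add: D_def)
  qed
  have D_le: "\<bar>D S ij\<bar> \<le> 2" if S: "S \<subseteq> ?I" and ij: "ij \<in> ?I" for S ij
  proof -
    obtain i j where [simp]: "ij = (i, j)" and i: "i < m" and j: "j < n" using ij ent by auto
    have "\<bar>Ahat (observed A S) $$ (i, j)\<bar> \<le> 1"
      using feas[OF S] i j by (simp add: candes_recht_feasible_def)
    thus ?thesis using bnd[OF i j] by (simp add: D_def)
  qed
  \<comment> \<open>The estimate and \<open>A\<close> both have nuclear norm at most
    \<open>sqrt r * sqrt N\<close>, whence the factor 2.\<close>
  define K where "K = 2 * (sqrt r * sqrt N)"
  have K0: "K \<ge> 0" using N by (simp add: K_def)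
  have "(\<Sum>i<m. \<Sum>j<n. (A $$ (i, j))\<^sup>2) \<le> (\<Sum>i<m. \<Sum>j<n. 1)"
    using bnd by (intro sum_mono) (auto simp: abs_square_le_1)
  hence frob: "(\<Sum>i<m. \<Sum>j<n. (A $$ (i, j))\<^sup>2) \<le> N" by (simp add: N_def)
  have "nuclear_norm A \<le> sqrt (mat_rank A) * sqrt (\<Sum>i<m. \<Sum>j<n. (A $$ (i, j))\<^sup>2)"
    by (rule nuclear_norm_le_rank[OF A])
  also have "\<dots> \<le> sqrt r * sqrt N"
    using rank frob by (intro mult_mono) (auto intro!: sum_nonneg)
  finally have nnA: "nuclear_norm A \<le> sqrt r * sqrt N" .
  have pairing: "\<bar>\<Sum>i<m. \<Sum>j<n. E i j * D S (i, j)\<bar> \<le> root 4 (gram_sq m n E) * K"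
    if S: "S \<subseteq> ?I" for S E
  proof -
    let ?Z = "Ahat (observed A S)"
    have Z: "?Z \<in> carrier_mat m n" using feas[OF S] by (simp add: candes_recht_feasible_def)
    have nnZ: "nuclear_norm ?Z \<le> nuclear_norm A"
      by (rule nuclear_norm_estimate_le[OF A bnd est[OF S]])
    have G0: "root 4 (gram_sq m n E) \<ge> 0" by (simp add: gram_sq_def sum_nonneg)
    \<comment> \<open>The error is split so that the estimate and \<open>A\<close> are each bounded
      by their own nuclear norm.\<close>
    have "(\<Sum>i<m. \<Sum>j<n. E i j * D S (i, j))
        = (\<Sum>i<m. \<Sum>j<n. E i j * ?Z $$ (i, j)) - (\<Sum>i<m. \<Sum>j<n. E i j * A $$ (i, j))"
      by (simp add: D_def right_diff_distrib sum_subtractf)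
    hence "\<bar>\<Sum>i<m. \<Sum>j<n. E i j * D S (i, j)\<bar>
        \<le> \<bar>\<Sum>i<m. \<Sum>j<n. E i j * ?Z $$ (i, j)\<bar> + \<bar>\<Sum>i<m. \<Sum>j<n. E i j * A $$ (i, j)\<bar>"
      by linarith
    also have "\<dots> \<le> root 4 (gram_sq m n E) * nuclear_norm ?Z + root 4 (gram_sq m n E) * nuclear_norm A"
      by (intro add_mono sum_entries_mult_le_nuclear_norm Z A)
    also have "\<dots> = root 4 (gram_sq m n E) * (nuclear_norm ?Z + nuclear_norm A)"
      by (simp add: distrib_left)
    also have "\<dots> \<le> root 4 (gram_sq m n E) * K"
      using nnZ nnA G0 by (intro mult_left_mono) (auto simp: K_def)
    finally show ?thesis .
  qed
  have "bernoulli_avg p ?I (\<lambda>S. \<Sum>ij\<in>?I. p ij * (D S ij)\<^sup>2)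
      \<le> 4 * K * root 4 (real m * real n * (real m + real n))"
    unfolding ent
    by (rule bernoulli_avg_weighted_square_le) (use p01 D_obs D_le pairing K0 ent in auto)
  also have "\<dots> = 8 * sqrt r * N * root 4 (1 / real m + 1 / real n)"
  proof -
    \<comment> \<open>The fourth root of \<open>N\<^sup>2\<close> is \<open>sqrt N\<close>, which
      together with the \<open>sqrt N\<close> in \<open>K\<close> gives the full factor
      \<open>N\<close>.\<close>
    have "real m * real n * (real m + real n) = N\<^sup>2 * (1 / real m + 1 / real n)"
      using mn by (simp add: N_def field_simps power2_eq_square)
    moreover have "root 4 (N\<^sup>2) = sqrt N"
      using N by (intro real_root_pos_unique) (auto simp: power4_eq_xxxx power2_eq_square)
    ultimately show ?thesis using N by (simp add: K_def real_root_mult mult_ac)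
  qed
  finally have weighted: "bernoulli_avg p ?I (\<lambda>S. \<Sum>ij\<in>?I. p ij * (D S ij)\<^sup>2)
      \<le> 8 * sqrt r * N * root 4 (1 / real m + 1 / real n)" .
  define c where "c = real (card {ij \<in> ?I. p ij < \<delta>})"
  have sq_le: "(\<Sum>ij\<in>?I. (D S ij)\<^sup>2) \<le> 4 * c + 1 / \<delta> * (\<Sum>ij\<in>?I. p ij * (D S ij)\<^sup>2)"
    if S: "S \<subseteq> ?I" for S
  proof -
    have "(D S ij)\<^sup>2 \<le> 4 * of_bool (p ij < \<delta>) + 1 / \<delta> * (p ij * (D S ij)\<^sup>2)" if ij: "ij \<in> ?I" for ij
    proof (cases "p ij < \<delta>")
      case True
      have "\<bar>D S ij\<bar>\<^sup>2 \<le> 2\<^sup>2" by (rule power_mono[OF D_le[OF S ij]]) simp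
      moreover have "0 \<le> 1 / \<delta> * (p ij * (D S ij)\<^sup>2)" using p01[OF ij] \<delta> by simp
      ultimately show ?thesis using True by simp
    next
      case False
      hence "1 \<le> p ij / \<delta>" using \<delta> by simp
      hence "1 * (D S ij)\<^sup>2 \<le> p ij / \<delta> * (D S ij)\<^sup>2" by (rule mult_right_mono) simp
      thus ?thesis using False by simp
    qed
    hence "(\<Sum>ij\<in>?I. (D S ij)\<^sup>2) \<le> (\<Sum>ij\<in>?I. 4 * of_bool (p ij < \<delta>) + 1 / \<delta> * (p ij * (D S ij)\<^sup>2))"
      by (rule sum_mono)
    also have "\<dots> = 4 * (\<Sum>ij\<in>?I. of_bool (p ij < \<delta>)) + 1 / \<delta> * (\<Sum>ij\<in>?I. p ij * (D S ij)\<^sup>2)"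
      by (simp only: sum.distrib sum_distrib_left)
    also have "(\<Sum>ij\<in>?I. of_bool (p ij < \<delta>)) = c"
      using fin by (simp add: c_def of_bool_def sum.If_cases Int_def)
    finally show ?thesis .
  qed
  define h where "h S = 1 / N * (\<Sum>ij\<in>?I. (D S ij)\<^sup>2)" for S
  have indep: "P.indep_events (\<lambda>ij. {\<omega> \<in> space P. ij \<in> R \<omega>}) ?I"
    and prob: "\<And>ij. ij \<in> ?I \<Longrightarrow> P.prob {\<omega> \<in> space P. ij \<in> R \<omega>} = p ij"
    using reveal unfolding reveals_independently_def p_def by auto
  have "P.expectation (\<lambda>\<omega>. 1 / (real m * real n) *
      (\<Sum>i<m. \<Sum>j<n. (Ahat (observed A (R \<omega>)) $$ (i, j) - A $$ (i, j))\<^sup>2))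
      = P.expectation (\<lambda>\<omega>. h (R \<omega> \<inter> ?I))"
    unfolding h_def D_def observed_Int_entries N_def
    by (simp only: ent sum.cartesian_product case_prod_unfold prod.collapse)
  also have "\<dots> = bernoulli_avg p ?I h"
    by (rule P.expectation_indep_events[OF fin indep prob])
  also have "\<dots> \<le> bernoulli_avg p ?I
      (\<lambda>S. 1 / N * (4 * c + 1 / \<delta> * (\<Sum>ij\<in>?I. p ij * (D S ij)\<^sup>2)))"
    unfolding h_def using p01 sq_le N by (intro bernoulli_avg_mono mult_left_mono) auto
  also have "\<dots> = 1 / N * (4 * c + 1 / \<delta> * bernoulli_avg p ?I (\<lambda>S. \<Sum>ij\<in>?I. p ij * (D S ij)\<^sup>2))"
    by (simp only: bernoulli_avg_cmult bernoulli_avg_add bernoulli_avg_const[OF fin])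
  also have "\<dots> \<le> 1 / N * (4 * c + 1 / \<delta> * (8 * sqrt r * N * root 4 (1 / real m + 1 / real n)))"
    using weighted N \<delta> by (intro mult_left_mono add_left_mono) auto
  also have "\<dots> = 4 * (c / N) + 8 * sqrt r / \<delta> * root 4 (1 / real m + 1 / real n)"
    using N by (simp add: field_simps)
  finally show ?thesis by (simp add: c_def N_def p_def)
qed

section \<open>Passage to the limit\<close>

theorem theorem2p4:
  fixes M :: "nat \<Rightarrow> real mat"
    and m n :: "nat \<Rightarrow> nat"
    and \<M> :: "real set"
    and f :: "real \<Rightarrow> real"
    and P :: "nat \<Rightarrow> 'w measure"
    and R :: "nat \<Rightarrow> 'w \<Rightarrow> (nat \<times> nat) set"
    and Mhat :: "nat \<Rightarrow> (nat \<times> nat \<rightharpoonup> real) \<Rightarrow> real mat"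
  assumes dims: "\<And>k. M k \<in> carrier_mat (m k) (n k)"
    and dims_lim: "filterlim m at_top sequentially" "filterlim n at_top sequentially"
    and \<M>_def: "\<M> = (\<Union>k. (\<lambda>ij. M k $$ ij) ` entries (M k))"
    and bounded_entries: "\<M> \<subseteq> {-1..1}"
    and f_prob: "\<And>x. x \<in> \<M> \<Longrightarrow> f x \<in> {0..1}"
    and prob: "\<And>k. prob_space (P k)"
    and reveal: "\<And>k. reveals_independently (P k) (R k) (M k) f"
    and rank_bdd: "bdd_above (range (\<lambda>k. mat_rank (M k)))"
    and weak_limits: "\<And>\<mu>. subseq_weak_limit (\<lambda>k. empirical_distribution (M k)) \<mu> \<Longrightarrow>
      \<exists>g. (\<forall>x\<in>\<M>. g x = f x) \<and>
          g \<in> borel_measurable (restrict_space borel {-1..1}) \<and>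
          g ` {-1..1} \<subseteq> {0..1::real} \<and>
          (AE x in \<mu>. g x \<noteq> 0 \<and> continuous (at x within {-1..1}) g)"
    and estimator: "\<And>k \<Omega>. \<Omega> \<subseteq> entries (M k) \<Longrightarrow>
      is_candes_recht_estimate (m k) (n k) (observed (M k) \<Omega>) (Mhat k (observed (M k) \<Omega>))"
  shows "(\<lambda>k. prob_space.expectation (P k) (\<lambda>\<omega>.
            (1 / (real (m k) * real (n k))) *
            (\<Sum>i<m k. \<Sum>j<n k.
               (Mhat k (observed (M k) (R k \<omega>)) $$ (i, j) - M k $$ (i, j))\<^sup>2)))
         \<longlonglongrightarrow> 0"
proof -
  let ?E = "\<lambda>k. prob_space.expectation (P k) (\<lambda>\<omega>. 1 / (real (m k) * real (n k)) *
    (\<Sum>i<m k. \<Sum>j<n k. (Mhat k (observed (M k) (R k \<omega>)) $$ (i, j) - M k $$ (i, j))\<^sup>2))"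
  obtain r where r: "\<And>k. mat_rank (M k) \<le> r"
    using rank_bdd unfolding bdd_above_def by auto
  have ent: "entries (M k) = {..<m k} \<times> {..<n k}" for k
    using dims[of k] by (simp add: entries_def)
  have in\<M>: "M k $$ ij \<in> \<M>" if "ij \<in> entries (M k)" for k ij
    using that unfolding \<M>_def by blast
  \<comment> \<open>Early matrices may be empty, and their empirical distributions are then no
    probability measures.\<close>
  have "\<forall>\<^sub>F k in sequentially. m k > 0 \<and> n k > 0"
    by (intro eventually_conj eventually_compose_filterlim[OF eventually_gt_at_top] dims_lim)
  then obtain k0 where k0: "\<And>k. k \<ge> k0 \<Longrightarrow> m k > 0 \<and> n k > 0"
    unfolding eventually_sequentially by blast
  have bound: "?E k \<le> 4 * (real (card {ij \<in> entries (M k). f (M k $$ ij) < \<delta>}) / (real (m k) * real (n k)))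
      + 8 * sqrt r / \<delta> * root 4 (1 / real (m k) + 1 / real (n k))" if "k \<ge> k0" "\<delta> > 0" for k \<delta>
  proof (rule estimation_error_le[OF dims _ _ _ _ prob reveal estimator r \<open>\<delta> > 0\<close>])
    show "m k > 0" "n k > 0" using k0[OF \<open>k \<ge> k0\<close>] by auto
    show "\<bar>M k $$ (i, j)\<bar> \<le> 1" if "i < m k" "j < n k" for i j
    proof -
      have "M k $$ (i, j) \<in> {-1..1}" using in\<M>[of "(i, j)" k] bounded_entries that by (auto simp: ent)
      thus ?thesis by auto
    qed
    show "f (M k $$ ij) \<in> {0..1}" if "ij \<in> entries (M k)" for ij
      using f_prob in\<M>[OF that] by blast
  qed
  have nonneg: "0 \<le> ?E k" for k
    by (intro Bochner_Integration.integral_nonneg mult_nonneg_nonneg sum_nonneg) auto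
  have lim_dims: "(\<lambda>k. 1 / real (m k) + 1 / real (n k)) \<longlonglongrightarrow> 0"
  proof -
    have "(\<lambda>k. 1 / real (q k)) \<longlonglongrightarrow> 0" if "filterlim q at_top sequentially" for q :: "nat \<Rightarrow> nat"
      using filterlim_compose[OF lim_1_over_n that] .
    from tendsto_add[OF this[OF dims_lim(1)] this[OF dims_lim(2)]] show ?thesis by simp
  qed
  show "?E \<longlonglongrightarrow> 0"
  proof (rule order_tendstoI)
    fix e :: real assume "e < 0"
    thus "\<forall>\<^sub>F k in sequentially. e < ?E k"
      using nonneg by (intro always_eventually allI) (rule less_le_trans)
  next
    fix e :: real assume e: "0 < e"
    \<comment> \<open>Each entry of small reveal probability costs 4, so the share
      \<open>e / 8\<close> takes up \<open>e / 2\<close> and leaves \<open>e / 2\<close> for the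
      term in the dimensions.\<close>
    have "\<exists>\<delta>>0. \<forall>\<^sub>F k in sequentially. measure (empirical_distribution (M k))
        {x \<in> (\<lambda>ij. M k $$ ij) ` entries (M k). f x < \<delta>} \<le> e / 8"
    proof (rule weak_limits_prob_small_values[of k0, OF _ _ _ bounded_entries])
      show "real_distribution (empirical_distribution (M k))" if "k \<ge> k0" for k
        using k0[OF that] by (intro real_distribution_empirical[OF dims]) auto
      show "AE x in empirical_distribution (M k). x \<in> (\<lambda>ij. M k $$ ij) ` entries (M k)"
        if "k \<ge> k0" for k
        using k0[OF that] by (intro AE_empirical[OF dims]) auto
      show "(\<lambda>ij. M k $$ ij) ` entries (M k) \<subseteq> \<M>" for k unfolding \<M>_def by blast
      show "\<exists>g. (\<forall>x\<in>\<M>. g x = f x) \<and> g \<in> borel_measurable (restrict_space borel {-1..1}) \<and>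
          g ` {-1..1} \<subseteq> {0..1::real} \<and> (AE x in \<nu>. g x \<noteq> 0 \<and> continuous (at x within {-1..1}) g)"
        if "subseq_weak_limit (\<lambda>k. empirical_distribution (M k)) \<nu>" for \<nu>
        using weak_limits[OF that] .
      show "e / 8 > 0" using e by simp
    qed
    then obtain \<delta> where \<delta>: "\<delta> > 0" and small: "\<forall>\<^sub>F k in sequentially.
        measure (empirical_distribution (M k)) {x \<in> (\<lambda>ij. M k $$ ij) ` entries (M k). f x < \<delta>} \<le> e / 8"
      by blast
    \<comment> \<open>Since \<open>\<delta>\<close> is fixed before \<open>k\<close> grows, its
      reciprocal is a mere constant here.\<close>
    have "(\<lambda>k. 8 * sqrt r / \<delta> * root 4 (1 / real (m k) + 1 / real (n k))) \<longlonglongrightarrow> 8 * sqrt r / \<delta> * root 4 0"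
      by (intro tendsto_mult_left tendsto_real_root lim_dims)
    hence "(\<lambda>k. 8 * sqrt r / \<delta> * root 4 (1 / real (m k) + 1 / real (n k))) \<longlonglongrightarrow> 0" by simp
    hence "\<forall>\<^sub>F k in sequentially. 8 * sqrt r / \<delta> * root 4 (1 / real (m k) + 1 / real (n k)) < e / 2"
      using e by (intro order_tendstoD(2)) auto
    moreover note small eventually_ge_at_top[of k0]
    ultimately show "\<forall>\<^sub>F k in sequentially. ?E k < e"
    proof eventually_elim
      case (elim k)
      have "real (card {ij \<in> entries (M k). f (M k $$ ij) < \<delta>}) / (real (m k) * real (n k)) \<le> e / 8"
        using elim(2) measure_empirical[OF dims, of k "\<lambda>x. f x < \<delta>"] k0[OF elim(3)] by simp
      with bound[OF elim(3) \<delta>] elim(1) show ?case by linarith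
    qed
  qed
qed

end
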